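(* Let $g$ be the Kerr-(anti-)de Sitter metric with real parameters $a,m,\Lambda$ (see context). Along the axis $\theta=0$ the invariant $I_5=k_\mu k^\mu$, $k_\mu=-\nabla_\mu(C_{\alpha\beta\gamma\delta}C^{\alpha\beta\gamma\delta})$, equals $$I_5=-\frac{1354752\,m^4\left(a^6-5a^4r^2+3a^2r^4-\frac17r^6\right)^2r^2\left(\Lambda r^4+(\Lambda a^2-3)r^2+6mr-3a^2\right)}{(a^2+r^2)^{15}}.$$ For all values of the Kerr parameter $a>0$ consistent with a Kerr-(anti-)de Sitter black hole, $I_5$ on the axis vanishes at the stationary black hole horizons (real roots of $\Delta_r$) and at the real positive roots of the sextic polynomial $a^6-5a^4r^2+3a^2r^4-\frac17r^6$ in $r$, which are $$r\simeq0.481574618807\,a,\qquad r\simeq1.2539603376\,a,\qquad r\simeq4.3812862675\,a.$$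
   Context: Kerr-(anti-)de Sitter metric: in coordinates $(t,r,\theta,\phi)$, signature $(-,+,+,+)$, $$ds^2=-\frac{\Delta_r}{\Xi^2\rho^2}(dt-a\sin^2\theta\,d\phi)^2+\frac{\rho^2}{\Delta_r}dr^2+\frac{\rho^2}{\Delta_\theta}d\theta^2+\frac{\Delta_\theta\sin^2\theta}{\Xi^2\rho^2}\big(a\,dt-(r^2+a^2)d\phi\big)^2,$$ $\Delta_\theta=1+\frac{a^2\Lambda}{3}\cos^2\theta$, $\Xi=1+\frac{a^2\Lambda}{3}\neq0$, $\Delta_r=(1-\frac{\Lambda}{3}r^2)(r^2+a^2)-2mr$, $\rho^2=r^2+a^2\cos^2\theta$. $C_{\alpha\beta\gamma\delta}$ is the Weyl tensor of $g$. $I_5$ is a rational function of $(r,\cos\theta)$ with denominator a power of $\rho^2$; its value on the axis $\theta=0$ and at points with $\Delta_r=0$ is obtained by continuity. The symbol $\simeq$ denotes decimal approximation. *)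

theory Defs
  imports "HOL-Analysis.Analysis"
begin

section \<open>Curvature of a metric in a coordinate chart of dimension four\<close>

text \<open>A metric is given by its matrix of components, as a function of the coordinate point.
  All index positions are explicit: an upper index precedes the lower ones.\<close>

type_synonym metric = "real^4 \<Rightarrow> real^4^4"

definition partial_deriv :: "4 \<Rightarrow> (real^4 \<Rightarrow> real) \<Rightarrow> real^4 \<Rightarrow> real" where
  "partial_deriv i f x = deriv (\<lambda>h. f (x + h *\<^sub>R axis i 1)) 0"

definition inv_metric :: "metric \<Rightarrow> metric" where
  "inv_metric g x = matrix_inv (g x)"

definition christoffel :: "metric \<Rightarrow> 4 \<Rightarrow> 4 \<Rightarrow> 4 \<Rightarrow> real^4 \<Rightarrow> real" where
  "christoffel g l i j x = (1/2) * (\<Sum>s\<in>UNIV. inv_metric g x $ l $ s *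
     (partial_deriv i (\<lambda>y. g y $ s $ j) x + partial_deriv j (\<lambda>y. g y $ s $ i) x
      - partial_deriv s (\<lambda>y. g y $ i $ j) x))"

definition riemann :: "metric \<Rightarrow> 4 \<Rightarrow> 4 \<Rightarrow> 4 \<Rightarrow> 4 \<Rightarrow> real^4 \<Rightarrow> real" where
  "riemann g p s i j x =
     partial_deriv i (christoffel g p j s) x - partial_deriv j (christoffel g p i s) x
     + (\<Sum>l\<in>UNIV. christoffel g p i l x * christoffel g l j s x
                 - christoffel g p j l x * christoffel g l i s x)"

definition riemann_low :: "metric \<Rightarrow> 4 \<Rightarrow> 4 \<Rightarrow> 4 \<Rightarrow> 4 \<Rightarrow> real^4 \<Rightarrow> real" where
  "riemann_low g p s i j x = (\<Sum>q\<in>UNIV. g x $ p $ q * riemann g q s i j x)"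

definition ricci :: "metric \<Rightarrow> 4 \<Rightarrow> 4 \<Rightarrow> real^4 \<Rightarrow> real" where
  "ricci g i j x = (\<Sum>p\<in>UNIV. riemann g p i p j x)"

definition scalar_curvature :: "metric \<Rightarrow> real^4 \<Rightarrow> real" where
  "scalar_curvature g x = (\<Sum>i\<in>UNIV. \<Sum>j\<in>UNIV. inv_metric g x $ i $ j * ricci g i j x)"

text \<open>The factors \<open>1/2\<close> and \<open>1/6\<close> are \<open>1/(n-2)\<close> and \<open>1/((n-1)(n-2))\<close> for \<open>n = 4\<close>.\<close>

definition weyl :: "metric \<Rightarrow> 4 \<Rightarrow> 4 \<Rightarrow> 4 \<Rightarrow> 4 \<Rightarrow> real^4 \<Rightarrow> real" where
  "weyl g i j k l x = riemann_low g i j k l x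
     - (1/2) * (g x $ i $ k * ricci g j l x - g x $ i $ l * ricci g j k x
              - g x $ j $ k * ricci g i l x + g x $ j $ l * ricci g i k x)
     + (1/6) * scalar_curvature g x * (g x $ i $ k * g x $ j $ l - g x $ i $ l * g x $ j $ k)"

definition weyl_up :: "metric \<Rightarrow> 4 \<Rightarrow> 4 \<Rightarrow> 4 \<Rightarrow> 4 \<Rightarrow> real^4 \<Rightarrow> real" where
  "weyl_up g i j k l x = (\<Sum>p\<in>UNIV. \<Sum>q\<in>UNIV. \<Sum>r\<in>UNIV. \<Sum>s\<in>UNIV.
     inv_metric g x $ i $ p * inv_metric g x $ j $ q *
     inv_metric g x $ k $ r * inv_metric g x $ l $ s * weyl g p q r s x)"

definition weyl_square :: "metric \<Rightarrow> real^4 \<Rightarrow> real" where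
  "weyl_square g x = (\<Sum>i\<in>UNIV. \<Sum>j\<in>UNIV. \<Sum>k\<in>UNIV. \<Sum>l\<in>UNIV.
     weyl g i j k l x * weyl_up g i j k l x)"

text \<open>The covariant derivative of a scalar is its partial derivative.\<close>

definition k_covector :: "metric \<Rightarrow> 4 \<Rightarrow> real^4 \<Rightarrow> real" where
  "k_covector g i x = - partial_deriv i (weyl_square g) x"

definition I5 :: "metric \<Rightarrow> real^4 \<Rightarrow> real" where
  "I5 g x = (\<Sum>i\<in>UNIV. \<Sum>j\<in>UNIV. inv_metric g x $ i $ j * k_covector g i x * k_covector g j x)"

section \<open>The Kerr-(anti-)de Sitter metric\<close>

definition Delta_r :: "real \<Rightarrow> real \<Rightarrow> real \<Rightarrow> real \<Rightarrow> real" where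
  "Delta_r a m \<Lambda> r = (1 - \<Lambda> / 3 * r^2) * (r^2 + a^2) - 2 * m * r"

definition Delta_theta :: "real \<Rightarrow> real \<Rightarrow> real \<Rightarrow> real" where
  "Delta_theta a \<Lambda> \<theta> = 1 + a^2 * \<Lambda> / 3 * (cos \<theta>)^2"

definition Xi :: "real \<Rightarrow> real \<Rightarrow> real" where
  "Xi a \<Lambda> = 1 + a^2 * \<Lambda> / 3"

definition rho2 :: "real \<Rightarrow> real \<Rightarrow> real \<Rightarrow> real" where
  "rho2 a r \<theta> = r^2 + a^2 * (cos \<theta>)^2"

text \<open>The coordinates \<open>(t, r, \<theta>, \<phi>)\<close> are the components 1, 2, 3, 4, and \<open>e0\<close>, \<open>e3\<close>
  are the components of the one-forms \<open>dt - a sin\<^sup>2\<theta> d\<phi>\<close> and \<open>a dt - (r\<^sup>2 + a\<^sup>2) d\<phi>\<close>.\<close>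

definition kerr_ds :: "real \<Rightarrow> real \<Rightarrow> real \<Rightarrow> metric" where
  "kerr_ds a m \<Lambda> x =
    (let r = x $ 2; \<theta> = x $ 3;
         e0 = (vector [1, 0, 0, - a * (sin \<theta>)^2] :: real^4);
         e1 = (axis 2 1 :: real^4);
         e2 = (axis 3 1 :: real^4);
         e3 = (vector [a, 0, 0, - (r^2 + a^2)] :: real^4)
     in \<chi> i j.
         - Delta_r a m \<Lambda> r / ((Xi a \<Lambda>)^2 * rho2 a r \<theta>) * (e0 $ i * e0 $ j)
         + rho2 a r \<theta> / Delta_r a m \<Lambda> r * (e1 $ i * e1 $ j)
         + rho2 a r \<theta> / Delta_theta a \<Lambda> \<theta> * (e2 $ i * e2 $ j)
         + Delta_theta a \<Lambda> \<theta> * (sin \<theta>)^2 / ((Xi a \<Lambda>)^2 * rho2 a r \<theta>) * (e3 $ i * e3 $ j))"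

text \<open>The points at which all coefficients are defined and the metric is nondegenerate.\<close>

definition regular_points :: "real \<Rightarrow> real \<Rightarrow> real \<Rightarrow> (real^4) set" where
  "regular_points a m \<Lambda> = {x. Delta_r a m \<Lambda> (x $ 2) \<noteq> 0 \<and> Delta_theta a \<Lambda> (x $ 3) \<noteq> 0 \<and>
     rho2 a (x $ 2) (x $ 3) \<noteq> 0 \<and> sin (x $ 3) \<noteq> 0}"

text \<open>The invariant, extended by continuity to the axis and to the zeros of \<open>Delta_r\<close>.\<close>

definition kerr_I5 :: "real \<Rightarrow> real \<Rightarrow> real \<Rightarrow> real^4 \<Rightarrow> real" where
  "kerr_I5 a m \<Lambda> x =
    (if x \<in> regular_points a m \<Lambda> then I5 (kerr_ds a m \<Lambda>) x
     else Lim (at x within regular_points a m \<Lambda>) (I5 (kerr_ds a m \<Lambda>)))"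

text \<open>Parameters of a black hole: the polar coefficient \<open>Delta_theta\<close> is positive for every
  \<open>\<theta>\<close> (so that the signature is Lorentzian), and there is an event horizon, that is, a positive
  root of \<open>Delta_r\<close> with \<open>Delta_r > 0\<close> immediately outside it. The inner, cosmological and
  negative roots are not required to exist; extremal black holes are included. A positive
  root with \<open>Delta_r < 0\<close> outside is an inner or a cosmological horizon, and does not count.\<close>

definition kerr_ds_black_hole :: "real \<Rightarrow> real \<Rightarrow> real \<Rightarrow> bool" where
  "kerr_ds_black_hole a m \<Lambda> \<longleftrightarrow>
     (\<forall>\<theta>. Delta_theta a \<Lambda> \<theta> > 0) \<and>
     (\<exists>r\<^sub>h>0. Delta_r a m \<Lambda> r\<^sub>h = 0 \<and> (\<forall>\<^sub>F r in at_right r\<^sub>h. Delta_r a m \<Lambda> r > 0))"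

definition sextic :: "real \<Rightarrow> real \<Rightarrow> real" where
  "sextic a r = a^6 - 5 * a^4 * r^2 + 3 * a^2 * r^4 - 1/7 * r^6"

text \<open>\<open>n / 10^d\<close> is the decimal expansion of \<open>x\<close> cut off after \<open>d\<close> places.\<close>

definition decimal_approx :: "nat \<Rightarrow> real \<Rightarrow> int \<Rightarrow> bool" where
  "decimal_approx d x n \<longleftrightarrow> \<lfloor>x * 10^d\<rfloor> = n"

end

theory Submission
  imports Defs
begin

text \<open>In Carter's frame, suitably rescaled, the metric is diagonal and the connection coefficients
  are polynomials in \<open>r\<close> and \<open>c = cos \<theta>\<close> divided by \<open>rho2\<close>. A torsion-free connection compatible with
  the metric is the Levi-Civita connection, so its curvature can be read off in the frame. It turns
  out that the metric is Einstein and that the Weyl tensor is the real part of a type D tensor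
  built from \<open>m / (r - \<i> a c)^3\<close>; hence the Weyl square is \<open>48 m\<^sup>2 Re (r - \<i> a c)\<^bsup>-6\<^esup>\<close>. On the axis the
  \<open>\<theta>\<close>-term of \<open>I\<^sub>5\<close> drops out, and the \<open>r\<close>-term contains the square of
  \<open>Re (r + \<i> a)^7\<close>, which is \<open>- 7 r\<close> times the sextic.\<close>

section \<open>Partial derivatives\<close>

text \<open>In coordinates the curvature components are unwieldy; in the frame they become
  polynomial identities, one for each choice of indices. An orthonormal frame would need square
  roots of \<open>Delta_r\<close>, whose sign differs from region to region. The squared lengths are
  therefore kept as functions \<open>h\<close>: no roots and no case distinction, at the price of
  the term \<open>dh\<close> in the compatibility condition. With \<open>c\<close> in place of the
  angle, the radial and the polar part have the same shape. The frame degenerates on the axis, where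
  the invariant is defined as a \<open>Lim\<close>. Two facts give it a value there: the closed
  formula found at regular points is continuous up to the axis, and every axis point with
  \<open>r^2 + a^2 \<noteq> 0\<close>, even one on a horizon, is a limit of regular points.\<close>

definition has_partial :: "4 \<Rightarrow> (real^4 \<Rightarrow> real) \<Rightarrow> real \<Rightarrow> real^4 \<Rightarrow> bool" where
  "has_partial i f D x \<longleftrightarrow> ((\<lambda>h. f (x + h *\<^sub>R axis i 1)) has_real_derivative D) (at 0)"

text \<open>\<open>deriv\<close> has a value for every function, so \<open>partial_deriv\<close>
  obeys no calculus without differentiability; \<open>has_partial\<close> carries differentiability
  and value together.\<close>

lemma has_partial_imp_partial_deriv: "has_partial i f D x \<Longrightarrow> partial_deriv i f x = D"
  unfolding has_partial_def partial_deriv_def by (rule DERIV_imp_deriv)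

lemma has_partial_unique: "has_partial i f D x \<Longrightarrow> has_partial i f D' x \<Longrightarrow> D = D'"
  using has_partial_imp_partial_deriv by metis

text \<open>A coordinate line through \<open>x\<close> stays in the open set \<open>S\<close> for
  small parameters. Formulas valid only at regular points can thus be differentiated.\<close>

lemma has_partial_transform:
  assumes "has_partial i f D x" "open S" "x \<in> S" "\<And>y. y \<in> S \<Longrightarrow> f y = g y"
  shows "has_partial i g D x"
proof -
  let ?T = "(\<lambda>h::real. x + h *\<^sub>R axis i 1) -` S"
  have "open ?T"
    by (intro open_vimage assms continuous_intros)
  moreover have "0 \<in> ?T" using assms by simp
  ultimately show ?thesis
    using assms(1,4) unfolding has_partial_def
    by (auto intro: has_field_derivative_transform_within_open)
qed

lemma has_partial_const: "has_partial i (\<lambda>y. k) 0 x"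
  unfolding has_partial_def by simp

lemma has_partial_diff:
  "has_partial i f D x \<Longrightarrow> has_partial i g D' x \<Longrightarrow> has_partial i (\<lambda>y. f y - g y) (D - D') x"
  unfolding has_partial_def by (rule DERIV_diff)

lemma has_partial_mult:
  "has_partial i f D x \<Longrightarrow> has_partial i g D' x \<Longrightarrow>
   has_partial i (\<lambda>y. f y * g y) (D * g x + f x * D') x"
  unfolding has_partial_def by (auto intro!: derivative_eq_intros)

lemma has_partial_sum:
  "(\<And>k. k \<in> A \<Longrightarrow> has_partial i (f k) (D k) x) \<Longrightarrow>
   has_partial i (\<lambda>y. \<Sum>k\<in>A. f k y) (\<Sum>k\<in>A. D k) x"
  unfolding has_partial_def by (rule DERIV_sum)

section \<open>Differentiation of matrix-valued functions\<close>

definition has_matrix_partial ::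
  "4 \<Rightarrow> (real^4 \<Rightarrow> real^4^4) \<Rightarrow> real^4^4 \<Rightarrow> real^4 \<Rightarrow> bool" where
  "has_matrix_partial i A D x \<longleftrightarrow> (\<forall>p q. has_partial i (\<lambda>y. A y $ p $ q) (D $ p $ q) x)"

lemma has_matrix_partialD:
  "has_matrix_partial i A D x \<Longrightarrow> has_partial i (\<lambda>y. A y $ p $ q) (D $ p $ q) x"
  unfolding has_matrix_partial_def by blast

lemma has_matrix_partial_unique:
  "has_matrix_partial i A D x \<Longrightarrow> has_matrix_partial i A D' x \<Longrightarrow> D = D'"
  unfolding has_matrix_partial_def vec_eq_iff using has_partial_unique by blast

lemma has_matrix_partial_transform:
  assumes "has_matrix_partial i A D x" "open S" "x \<in> S" "\<And>y. y \<in> S \<Longrightarrow> A y = B y"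
  shows "has_matrix_partial i B D x"
  unfolding has_matrix_partial_def
  by (intro allI has_partial_transform[OF has_matrix_partialD[OF assms(1)] assms(2,3)])
    (simp add: assms(4))

lemma has_matrix_partial_const: "has_matrix_partial i (\<lambda>y. K) 0 x"
  unfolding has_matrix_partial_def by (simp add: has_partial_const)

lemma has_matrix_partial_diff:
  "has_matrix_partial i A D x \<Longrightarrow> has_matrix_partial i B D' x \<Longrightarrow>
   has_matrix_partial i (\<lambda>y. A y - B y) (D - D') x"
  unfolding has_matrix_partial_def by (auto intro: has_partial_diff)

lemma has_matrix_partial_mult:
  assumes "has_matrix_partial i A D x" "has_matrix_partial i B D' x"
  shows "has_matrix_partial i (\<lambda>y. A y ** B y) (D ** B x + A x ** D') x"
  using assms unfolding has_matrix_partial_def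
  by (auto simp: matrix_matrix_mult_def simp flip: sum.distrib
      intro!: has_partial_sum has_partial_mult)

lemma has_matrix_partial_transpose:
  "has_matrix_partial i A D x \<Longrightarrow>
   has_matrix_partial i (\<lambda>y. transpose (A y)) (transpose D) x"
  unfolding has_matrix_partial_def by (auto simp: transpose_def)

text \<open>Stationarity and axial symmetry: the scalar functions in question do not involve the
  first and fourth coordinates, so one rule serves all four directions.\<close>

lemma has_partial_two:
  assumes "((\<lambda>r. F r (y $ 3)) has_real_derivative Fr) (at (y $ 2))"
    and "((\<lambda>t. F (y $ 2) t) has_real_derivative Ft) (at (y $ 3))"
  shows "has_partial i (\<lambda>y. F (y $ 2) (y $ 3)) (if i = 2 then Fr else if i = 3 then Ft else 0) y"
proof -
  have "\<forall>i. has_partial i (\<lambda>y. F (y $ 2) (y $ 3)) (if i = 2 then Fr else if i = 3 then Ft else 0) y"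
    using assms DERIV_shift[of "\<lambda>r. F r (y $ 3)" Fr 0 "y $ 2"]
      DERIV_shift[of "\<lambda>t. F (y $ 2) t" Ft 0 "y $ 3"]
    unfolding forall_4 has_partial_def by (simp add: axis_def add.commute)
  then show ?thesis by blast
qed

lemma has_matrix_partial_ex:
  assumes "\<And>p q. \<exists>d. has_partial i (\<lambda>y. A y $ p $ q) d x"
  shows "\<exists>D. has_matrix_partial i A D x"
proof -
  obtain d where "\<And>p q. has_partial i (\<lambda>y. A y $ p $ q) (d p q) x"
    using assms by metis
  then have "has_matrix_partial i A (\<chi> p q. d p q) x"
    unfolding has_matrix_partial_def by simp
  then show ?thesis by blast
qed

section \<open>Curvature in an orthogonal frame\<close>

lemma matrix_mult_component: "(A ** B) $ i $ j = (\<Sum>k\<in>UNIV. A $ i $ k * B $ k $ j)"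
  by (simp add: matrix_matrix_mult_def)

lemma matrix_add_rdistrib: "(A + B) ** C = A ** C + B ** (C :: real^'n^'m)"
  by (vector matrix_matrix_mult_def sum.distrib distrib_right)

lemma matrix_sub_ldistrib: "A ** (B - C) = A ** B - A ** (C :: real^'n^'m)"
  by (vector matrix_matrix_mult_def sum_subtractf right_diff_distrib)

lemma matrix_sub_rdistrib: "(A - B) ** C = A ** C - B ** (C :: real^'n^'m)"
  by (vector matrix_matrix_mult_def sum_subtractf left_diff_distrib)

lemma matrix_minus_left: "(- A) ** C = - (A ** (C :: real^'n^'m))"
  by (vector matrix_matrix_mult_def sum_negf)

lemma matrix_minus_right: "A ** (- C) = - (A ** (C :: real^'n^'m))"
  by (vector matrix_matrix_mult_def sum_negf)

lemmas matrix_ring = matrix_add_ldistrib matrix_add_rdistrib matrix_sub_ldistrib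
  matrix_sub_rdistrib matrix_minus_left matrix_minus_right

lemma transpose_diag_component:
  fixes T :: "real^'n^'n"
  shows "(transpose T ** (\<chi> a b. if a = b then k a else 0) ** T) $ i $ j =
    (\<Sum>a\<in>UNIV. k a * T $ a $ i * T $ a $ j)"
proof -
  have "(transpose T ** (\<chi> a b. if a = b then k a else 0)) $ i $ a = k a * T $ a $ i" for a
  proof -
    have "(transpose T ** (\<chi> a b. if a = b then k a else 0)) $ i $ a =
        (\<Sum>j\<in>UNIV. if j = a then k a * T $ a $ i else 0)"
      unfolding matrix_matrix_mult_def transpose_def vec_lambda_beta
      by (intro sum.cong refl) auto
    then show ?thesis by simp
  qed
  then show ?thesis
    by (simp add: matrix_mult_component[of "_ ** _"])
qed

lemma sum_delta_mult:
  fixes v :: real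
  shows "(\<Sum>d\<in>UNIV. (if d = k then v else 0) * G d) = v * G (k :: 'a :: finite)"
proof -
  have "(if d = k then v else 0) * G d = (if d = k then v * G k else 0)" for d
    by simp
  then show ?thesis by simp
qed

lemma sum_mult_delta:
  fixes v :: real
  shows "(\<Sum>d\<in>UNIV. G d * (if d = k then v else 0)) = G (k :: 'a :: finite) * v"
  using sum_delta_mult[of k v G] by (simp only: mult.commute)

lemma sum_swap_inner:
  "(\<Sum>p\<in>P. \<Sum>a\<in>A. \<Sum>b\<in>B. \<Sum>c\<in>C. \<Sum>d\<in>D. X p a b c d) =
    (\<Sum>a\<in>A. \<Sum>b\<in>B. \<Sum>c\<in>C. \<Sum>d\<in>D. \<Sum>p\<in>P. X p a b c d)"
proof -
  have "(\<Sum>p\<in>P. \<Sum>c\<in>C. \<Sum>d\<in>D. X p a b c d) = (\<Sum>c\<in>C. \<Sum>d\<in>D. \<Sum>p\<in>P. X p a b c d)" for a b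
    by (rule trans[OF sum.swap]) (rule sum.cong[OF refl], rule sum.swap)
  moreover have "(\<Sum>p\<in>P. \<Sum>a\<in>A. \<Sum>b\<in>B. \<Sum>c\<in>C. \<Sum>d\<in>D. X p a b c d) =
      (\<Sum>a\<in>A. \<Sum>b\<in>B. \<Sum>p\<in>P. \<Sum>c\<in>C. \<Sum>d\<in>D. X p a b c d)"
    by (rule trans[OF sum.swap]) (rule sum.cong[OF refl], rule sum.swap)
  ultimately show ?thesis by (simp only:)
qed

text \<open>Column \<open>a\<close> of \<open>E\<close> holds the coordinates of the frame vector \<open>e\<^sub>a\<close>, row \<open>a\<close> of \<open>\<theta>\<close> those of the
  dual one-form. The frame is orthogonal with squared lengths \<open>h a\<close>, and \<open>\<gamma> a b c\<close> is the
  coefficient of \<open>e\<^sub>a\<close> in the covariant derivative of \<open>e\<^sub>b\<close> along \<open>e\<^sub>c\<close>. A first index \<open>d\<close>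
  of \<open>dh\<close> and \<open>d\<gamma>\<close> denotes the derivative along \<open>e\<^sub>d\<close>; \<open>dE\<close> and \<open>ddE\<close> are
  coordinate derivatives.\<close>

locale orthogonal_frame =
  fixes g :: metric and S :: "(real^4) set"
    and E \<theta> :: "real^4 \<Rightarrow> real^4^4" and h :: "4 \<Rightarrow> real^4 \<Rightarrow> real"
    and \<gamma> :: "4 \<Rightarrow> 4 \<Rightarrow> 4 \<Rightarrow> real^4 \<Rightarrow> real"
    and dE :: "4 \<Rightarrow> real^4 \<Rightarrow> real^4^4" and ddE :: "4 \<Rightarrow> 4 \<Rightarrow> real^4 \<Rightarrow> real^4^4"
    and dh :: "4 \<Rightarrow> 4 \<Rightarrow> real^4 \<Rightarrow> real" and d\<gamma> :: "4 \<Rightarrow> 4 \<Rightarrow> 4 \<Rightarrow> 4 \<Rightarrow> real^4 \<Rightarrow> real"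
  assumes open_S: "open S"
    and metric_eq: "y \<in> S \<Longrightarrow> g y = transpose (\<theta> y) ** (\<chi> a b. if a = b then h a y else 0) ** \<theta> y"
    and h_nonzero: "y \<in> S \<Longrightarrow> h a y \<noteq> 0"
    and dual: "y \<in> S \<Longrightarrow> \<theta> y ** E y = mat 1"
    and E_deriv: "y \<in> S \<Longrightarrow> has_matrix_partial i E (dE i y) y"
    and dE_deriv: "y \<in> S \<Longrightarrow> has_matrix_partial i (dE j) (ddE i j y) y"
    and ddE_sym: "y \<in> S \<Longrightarrow> ddE i j y = ddE j i y"
    and \<theta>_differentiable: "y \<in> S \<Longrightarrow> \<exists>D. has_matrix_partial i \<theta> D y"
    and h_deriv: "y \<in> S \<Longrightarrow> has_partial i (h a) (\<Sum>c\<in>UNIV. \<theta> y $ c $ i * dh c a y) y"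
    and \<gamma>_deriv: "y \<in> S \<Longrightarrow>
      has_partial i (\<gamma> a b c) (\<Sum>d\<in>UNIV. \<theta> y $ d $ i * d\<gamma> d a b c y) y"
    and compatible: "y \<in> S \<Longrightarrow>
      h a y * \<gamma> a b c y + h b y * \<gamma> b a c y = (if a = b then dh c a y else 0)"
    and torsion_free: "y \<in> S \<Longrightarrow>
      (\<Sum>l\<in>UNIV. E y $ l $ c * dE l y $ p $ b - E y $ l $ b * dE l y $ p $ c) =
      (\<Sum>a\<in>UNIV. (\<gamma> a b c y - \<gamma> a c b y) * E y $ p $ a)"
begin

section \<open>Connection and curvature matrices of the frame\<close>

definition H :: "real^4 \<Rightarrow> real^4^4" where
  "H y = (\<chi> a b. if a = b then h a y else 0)"

text \<open>The connection one-forms, evaluated on the coordinate vector \<open>j\<close>.\<close>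

definition \<omega> :: "4 \<Rightarrow> real^4 \<Rightarrow> real^4^4" where
  "\<omega> j y = (\<chi> a b. \<Sum>c\<in>UNIV. \<gamma> a b c y * \<theta> y $ c $ j)"

text \<open>The connection carried back to coordinates: writing the covariant derivative of the
  columns of \<open>E\<close> in two ways gives
  \<open>\<Gamma> j ** E + dE j = E ** \<omega> j\<close>, which is solved for
  \<open>\<Gamma> j\<close>.\<close>

definition \<Gamma> :: "4 \<Rightarrow> real^4 \<Rightarrow> real^4^4" where
  "\<Gamma> j y = (E y ** \<omega> j y - dE j y) ** \<theta> y"

definition d\<theta> :: "4 \<Rightarrow> real^4 \<Rightarrow> real^4^4" where
  "d\<theta> i y = - (\<theta> y ** dE i y ** \<theta> y)"

definition d\<omega> :: "4 \<Rightarrow> 4 \<Rightarrow> real^4 \<Rightarrow> real^4^4" where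
  "d\<omega> i j y = (\<chi> a b. \<Sum>c\<in>UNIV. (\<Sum>d\<in>UNIV. \<theta> y $ d $ i * d\<gamma> d a b c y) * \<theta> y $ c $ j
     + \<gamma> a b c y * d\<theta> i y $ c $ j)"

definition dH :: "4 \<Rightarrow> real^4 \<Rightarrow> real^4^4" where
  "dH i y = (\<chi> a b. if a = b then (\<Sum>c\<in>UNIV. \<theta> y $ c $ i * dh c a y) else 0)"

text \<open>The first product under the sum is the contribution of the bracket of \<open>e_c\<close>
  and \<open>e_d\<close>, whose components are differences of \<open>\<gamma>\<close> because the
  torsion vanishes.\<close>

definition R :: "4 \<Rightarrow> 4 \<Rightarrow> 4 \<Rightarrow> 4 \<Rightarrow> real^4 \<Rightarrow> real" where
  "R a b c d y = d\<gamma> c a b d y - d\<gamma> d a b c y +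
     (\<Sum>e\<in>UNIV. \<gamma> a b e y * (\<gamma> e c d y - \<gamma> e d c y)
        + \<gamma> a e c y * \<gamma> e b d y - \<gamma> a e d y * \<gamma> e b c y)"

lemma dual': "y \<in> S \<Longrightarrow> E y ** \<theta> y = mat 1"
  using dual[of y] matrix_left_right_inverse[of "\<theta> y" "E y"] by simp

lemma dual_sum: "y \<in> S \<Longrightarrow> (\<Sum>i\<in>UNIV. \<theta> y $ a $ i * E y $ i $ b) = (if a = b then 1 else 0)"
  using dual[of y] by (simp add: vec_eq_iff matrix_matrix_mult_def mat_def)

lemma dual_sum': "y \<in> S \<Longrightarrow> (\<Sum>a\<in>UNIV. E y $ i $ a * \<theta> y $ a $ j) = (if i = j then 1 else 0)"
  using dual'[of y] by (simp add: vec_eq_iff matrix_matrix_mult_def mat_def)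

lemma g_eq: "y \<in> S \<Longrightarrow> g y = transpose (\<theta> y) ** H y ** \<theta> y"
  using metric_eq unfolding H_def by simp

text \<open>Differentiating \<open>\<theta> ** E = mat 1\<close> forces the value once a derivative
  exists, so explicit derivatives are required of \<open>E\<close> only.\<close>

lemma \<theta>_deriv:
  assumes "y \<in> S"
  shows "has_matrix_partial i \<theta> (d\<theta> i y) y"
proof -
  obtain D where D: "has_matrix_partial i \<theta> D y"
    using \<theta>_differentiable assms by blast
  have "has_matrix_partial i (\<lambda>y. \<theta> y ** E y) (D ** E y + \<theta> y ** dE i y) y"
    by (intro has_matrix_partial_mult D E_deriv assms)
  moreover have "has_matrix_partial i (\<lambda>y. \<theta> y ** E y) 0 y"
    by (rule has_matrix_partial_transform[OF has_matrix_partial_const open_S assms])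
      (simp add: dual)
  ultimately have "D ** E y + \<theta> y ** dE i y = 0"
    by (rule has_matrix_partial_unique)
  then have "D ** E y = - (\<theta> y ** dE i y)"
    by (rule eq_neg_iff_add_eq_0[THEN iffD2])
  then have "D ** (E y ** \<theta> y) = - (\<theta> y ** dE i y) ** \<theta> y"
    by (metis matrix_mul_assoc)
  then have "D = d\<theta> i y"
    unfolding d\<theta>_def dual'[OF assms] by (simp only: matrix_mul_rid matrix_minus_left)
  with D show ?thesis by (simp only:)
qed

lemma H_deriv: "y \<in> S \<Longrightarrow> has_matrix_partial i H (dH i y) y"
  unfolding has_matrix_partial_def H_def dH_def
  by (intro allI, case_tac "p = q") (simp_all add: h_deriv has_partial_const)

lemma dH_eq:
  assumes "y \<in> S"
  shows "dH i y = H y ** \<omega> i y + transpose (\<omega> i y) ** H y"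
proof -
  have "dH i y $ a $ b = (H y ** \<omega> i y + transpose (\<omega> i y) ** H y) $ a $ b" for a b
  proof -
    have "(H y ** \<omega> i y + transpose (\<omega> i y) ** H y) $ a $ b =
        (\<Sum>c\<in>UNIV. (h a y * \<gamma> a b c y + h b y * \<gamma> b a c y) * \<theta> y $ c $ i)"
      by (simp add: H_def \<omega>_def matrix_matrix_mult_def transpose_def if_distrib
          if_distribR sum_distrib_left sum_distrib_right sum.distrib ring_distribs mult_ac
          cong: if_cong)
    also have "\<dots> = dH i y $ a $ b"
      unfolding compatible[OF assms] by (simp add: dH_def mult.commute)
    finally show ?thesis by simp
  qed
  then show ?thesis by (simp add: vec_eq_iff)
qed

text \<open>Compatibility in coordinates: \<open>g ** \<Gamma> i\<close> holds the Christoffel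
  symbols of the first kind, and the two terms are those of a vanishing covariant derivative of
  \<open>g\<close>.\<close>

lemma g_deriv:
  assumes "y \<in> S"
  shows "has_matrix_partial i g (g y ** \<Gamma> i y + transpose (g y ** \<Gamma> i y)) y"
proof -
  let ?T = "\<theta> y" and ?D = "d\<theta> i y"
  have HT: "transpose (H y) = H y"
    unfolding H_def transpose_def by (auto simp: vec_eq_iff)
  have "has_matrix_partial i (\<lambda>y. transpose (\<theta> y) ** H y ** \<theta> y)
    ((transpose ?D ** H y + transpose ?T ** dH i y) ** ?T + transpose ?T ** H y ** ?D) y"
    by (intro has_matrix_partial_mult has_matrix_partial_transpose \<theta>_deriv H_deriv assms)
  then have g: "has_matrix_partial i g
    ((transpose ?D ** H y + transpose ?T ** dH i y) ** ?T + transpose ?T ** H y ** ?D) y"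
    by (rule has_matrix_partial_transform[OF _ open_S assms]) (simp add: g_eq)
  have "?T ** \<Gamma> i y = \<omega> i y ** ?T + ?D"
    unfolding \<Gamma>_def d\<theta>_def by (simp add: matrix_ring matrix_mul_assoc dual assms)
  then have gG: "g y ** \<Gamma> i y = transpose ?T ** H y ** (\<omega> i y ** ?T + ?D)"
    using assms by (simp add: g_eq flip: matrix_mul_assoc)
  have "transpose (A + B) = transpose A + transpose B" for A B :: "real^4^4"
    by (vector transpose_def)
  then have "(transpose ?D ** H y + transpose ?T ** dH i y) ** ?T + transpose ?T ** H y ** ?D
      = g y ** \<Gamma> i y + transpose (g y ** \<Gamma> i y)"
    unfolding gG dH_eq[OF assms]
    by (simp add: matrix_transpose_mul HT matrix_ring matrix_mul_assoc)
  with g show ?thesis by simp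
qed

section \<open>Identification with the Levi-Civita connection\<close>

text \<open>\<open>matrix_inv\<close> is a choice. The explicit inverse \<open>G\<close> shows that
  there is something to choose, and uniqueness of inverses then identifies the chosen matrix with
  \<open>G\<close>.\<close>

lemma inv_metric_eq:
  assumes "y \<in> S"
  shows "inv_metric g y $ i $ j = (\<Sum>a\<in>UNIV. E y $ i $ a * E y $ j $ a / h a y)"
    and "inv_metric g y ** g y = mat 1"
proof -
  define K :: "real^4^4" where "K = (\<chi> a b. if a = b then 1 / h a y else 0)"
  have KH: "K ** H y = mat 1"
  proof -
    have "(K ** H y) $ a $ b = (\<Sum>k\<in>UNIV. if k = a then (if a = b then 1 else 0) else 0)" for a b
      unfolding K_def H_def matrix_matrix_mult_def
      unfolding vec_lambda_beta using h_nonzero[OF assms] by (intro sum.cong refl) auto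
    then show ?thesis by (simp add: vec_eq_iff mat_def)
  qed
  have EK: "(E y ** K) $ i $ a = E y $ i $ a / h a y" for i a
  proof -
    have "(E y ** K) $ i $ a = (\<Sum>k\<in>UNIV. if k = a then E y $ i $ a / h a y else 0)"
      unfolding K_def matrix_matrix_mult_def vec_lambda_beta by (intro sum.cong refl) auto
    then show ?thesis by simp
  qed
  define G where "G = E y ** K ** transpose (E y)"
  have ET: "transpose (E y) ** transpose (\<theta> y) = mat 1"
    using dual[OF assms] by (simp flip: matrix_transpose_mul)
  have "G ** g y = E y ** (K ** ((transpose (E y) ** transpose (\<theta> y)) ** (H y ** \<theta> y)))"
    unfolding G_def g_eq[OF assms] by (simp only: matrix_mul_assoc)
  also have "\<dots> = E y ** ((K ** H y) ** \<theta> y)"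
    unfolding ET by (simp only: matrix_mul_assoc matrix_mul_lid)
  also have "\<dots> = mat 1"
    unfolding KH by (simp add: dual'[OF assms])
  finally have Gg: "G ** g y = mat 1" .
  then have gG: "g y ** G = mat 1"
    using matrix_left_right_inverse[of G "g y"] by simp
  have "invertible (g y)"
    unfolding invertible_def using Gg gG by blast
  then show i: "inv_metric g y ** g y = mat 1"
    unfolding inv_metric_def invertible_def matrix_inv_def by (rule someI2_ex) blast
  have "inv_metric g y = inv_metric g y ** (g y ** G)"
    unfolding gG by simp
  also have "\<dots> = G"
    unfolding matrix_mul_assoc i by simp
  finally have "inv_metric g y = G" .
  then show "inv_metric g y $ i $ j = (\<Sum>a\<in>UNIV. E y $ i $ a * E y $ j $ a / h a y)"
    unfolding G_def matrix_matrix_mult_def[of "_ ** _"] by (simp add: EK transpose_def)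
qed

lemma frame_components:
  assumes "y \<in> S"
  shows "(\<Sum>c\<in>UNIV. \<theta> y $ c $ j * (\<Sum>i\<in>UNIV. E y $ i $ c * f i)) = f j"
proof -
  have "(\<Sum>c\<in>UNIV. \<theta> y $ c $ j * (\<Sum>i\<in>UNIV. E y $ i $ c * f i)) =
      (\<Sum>i\<in>UNIV. f i * (\<Sum>c\<in>UNIV. E y $ i $ c * \<theta> y $ c $ j))"
    by (simp add: sum_distrib_left mult_ac) (rule sum.swap)
  also have "\<dots> = f j"
    by (simp add: dual_sum'[OF assms] if_distrib cong: if_cong)
  finally show ?thesis .
qed

lemma \<Gamma>_sym:
  assumes "y \<in> S"
  shows "\<Gamma> j y $ p $ s = \<Gamma> s y $ p $ j"
proof -
  \<comment> \<open>\<open>B b c\<close> is component \<open>p\<close> of the bilinear form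
    \<open>\<Gamma>\<close> evaluated on the frame vectors \<open>b\<close> and \<open>c\<close>;
    the torsion condition says precisely that it is symmetric.\<close>
  define B where "B b c = (\<Sum>a\<in>UNIV. E y $ p $ a * \<gamma> a b c y)
    - (\<Sum>l\<in>UNIV. E y $ l $ c * dE l y $ p $ b)" for b c
  have sym: "B b c = B c b" for b c
    using torsion_free[OF assms, of c p b] unfolding B_def
    by (simp add: sum_subtractf algebra_simps)
  have G: "\<Gamma> j y $ p $ s = (\<Sum>b\<in>UNIV. \<Sum>c\<in>UNIV. B b c * \<theta> y $ c $ j * \<theta> y $ b $ s)" for j s
  proof -
    have "(E y ** \<omega> j y - dE j y) $ p $ b = (\<Sum>c\<in>UNIV. B b c * \<theta> y $ c $ j)" for b
    proof -
      have "dE j y $ p $ b = (\<Sum>c\<in>UNIV. \<theta> y $ c $ j * (\<Sum>l\<in>UNIV. E y $ l $ c * dE l y $ p $ b))"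
        using frame_components[OF assms, of j "\<lambda>l. dE l y $ p $ b"] by simp
      moreover have "(E y ** \<omega> j y) $ p $ b =
          (\<Sum>c\<in>UNIV. \<theta> y $ c $ j * (\<Sum>a\<in>UNIV. E y $ p $ a * \<gamma> a b c y))"
        by (simp add: matrix_matrix_mult_def \<omega>_def sum_distrib_left mult_ac) (rule sum.swap)
      ultimately show ?thesis
        by (simp add: B_def algebra_simps sum_subtractf)
    qed
    then show ?thesis
      unfolding \<Gamma>_def by (simp add: matrix_matrix_mult_def sum_distrib_right)
  qed
  show ?thesis
    unfolding G by (subst sum.swap) (simp add: sym mult_ac)
qed

text \<open>Uniqueness of the Levi-Civita connection: in the combination of three derivatives of
  \<open>g\<close>, compatibility and symmetry cancel all terms but two equal ones.\<close>

lemma christoffel_eq: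
  assumes "y \<in> S"
  shows "christoffel g p j s y = \<Gamma> j y $ p $ s"
proof -
  let ?L = "\<lambda>q j s. \<Sum>l\<in>UNIV. g y $ q $ l * \<Gamma> j y $ l $ s"
  have pd: "partial_deriv i (\<lambda>y. g y $ q $ s) y = ?L q i s + ?L s i q" for i q s
    using has_partial_imp_partial_deriv[OF has_matrix_partialD[OF g_deriv[OF assms]]]
    by (simp add: matrix_matrix_mult_def transpose_def)
  have L: "?L q j s = ?L q s j" for q j s
    using \<Gamma>_sym[OF assms] by simp
  have "(1/2) * (partial_deriv j (\<lambda>y. g y $ q $ s) y + partial_deriv s (\<lambda>y. g y $ q $ j) y
      - partial_deriv q (\<lambda>y. g y $ j $ s) y) = ?L q j s" for q
    unfolding pd using L[of q j s] L[of s j q] L[of j s q] by simp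
  then have "christoffel g p j s y = (\<Sum>q\<in>UNIV. inv_metric g y $ p $ q * ?L q j s)"
    unfolding christoffel_def by (simp add: sum_distrib_left flip: mult.left_commute)
  also have "\<dots> = (inv_metric g y ** (g y ** \<Gamma> j y)) $ p $ s"
    by (simp add: matrix_matrix_mult_def)
  also have "\<dots> = \<Gamma> j y $ p $ s"
    using inv_metric_eq(2)[OF assms] by (simp add: matrix_mul_assoc)
  finally show ?thesis .
qed

section \<open>Cartan's structure equations\<close>

lemma \<omega>_deriv: "y \<in> S \<Longrightarrow> has_matrix_partial i (\<omega> j) (d\<omega> i j y) y"
  unfolding has_matrix_partial_def \<omega>_def d\<omega>_def
  by (auto intro!: has_partial_sum has_partial_mult \<gamma>_deriv has_matrix_partialD[OF \<theta>_deriv])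

definition \<Omega> :: "4 \<Rightarrow> 4 \<Rightarrow> real^4 \<Rightarrow> real^4^4" where
  "\<Omega> i j y = d\<omega> i j y - d\<omega> j i y + \<omega> i y ** \<omega> j y - \<omega> j y ** \<omega> i y"

text \<open>Curvature changes tensorially under the change of frame: the terms with first
  derivatives of \<open>E\<close> cancel, and those with second derivatives cancel by
  \<open>ddE_sym\<close>.\<close>

lemma riemann_eq_\<Omega>:
  assumes "y \<in> S"
  shows "riemann g p s i j y = (E y ** \<Omega> i j y ** \<theta> y) $ p $ s"
proof -
  define d\<Gamma> where "d\<Gamma> i j = (dE i y ** \<omega> j y + E y ** d\<omega> i j y - ddE i j y) ** \<theta> y
    + (E y ** \<omega> j y - dE j y) ** d\<theta> i y" for i j
  have "has_matrix_partial i (\<Gamma> j) (d\<Gamma> i j) y" for i j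
    unfolding \<Gamma>_def d\<Gamma>_def
    by (intro has_matrix_partial_mult has_matrix_partial_diff E_deriv dE_deriv \<omega>_deriv \<theta>_deriv
        assms)
  then have "has_partial i (christoffel g p j s) (d\<Gamma> i j $ p $ s) y" for i j p s
    by (rule has_partial_transform[OF has_matrix_partialD open_S assms])
      (simp add: christoffel_eq)
  then have "partial_deriv i (christoffel g p j s) y = d\<Gamma> i j $ p $ s" for i j p s
    by (rule has_partial_imp_partial_deriv)
  then have "riemann g p s i j y =
      (d\<Gamma> i j - d\<Gamma> j i + \<Gamma> i y ** \<Gamma> j y - \<Gamma> j y ** \<Gamma> i y) $ p $ s"
    unfolding riemann_def
    by (simp add: christoffel_eq[OF assms] sum_subtractf
        matrix_matrix_mult_def)
  moreover have "\<Gamma> i y ** \<Gamma> j y = (E y ** \<omega> i y - dE i y) ** (\<omega> j y - \<theta> y ** dE j y) ** \<theta> y"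
    for i j
  proof -
    have "\<Gamma> i y ** \<Gamma> j y =
        (E y ** \<omega> i y - dE i y) ** (\<theta> y ** (E y ** \<omega> j y - dE j y)) ** \<theta> y"
      unfolding \<Gamma>_def by (simp add: matrix_mul_assoc)
    moreover have "\<theta> y ** (E y ** \<omega> j y - dE j y) = \<omega> j y - \<theta> y ** dE j y"
      by (simp add: matrix_ring matrix_mul_assoc dual assms)
    ultimately show ?thesis by simp
  qed
  ultimately show ?thesis
    unfolding d\<Gamma>_def d\<theta>_def \<Omega>_def
    using ddE_sym[OF assms, of i j]
    by (simp add: matrix_ring matrix_mul_assoc algebra_simps)
qed

text \<open>The first structure equation: the torsion condition is passed from the brackets of the
  frame vectors to the exterior derivatives of the dual forms.\<close>

lemma d\<theta>_alt:
  assumes "y \<in> S"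
  shows "d\<theta> i y $ c $ j - d\<theta> j y $ c $ i =
    (\<Sum>d\<in>UNIV. \<Sum>e\<in>UNIV. (\<gamma> c d e y - \<gamma> c e d y) * \<theta> y $ d $ i * \<theta> y $ e $ j)"
proof -
  define B where "B d e = (\<Sum>l\<in>UNIV. \<theta> y $ c $ l * (\<Sum>k\<in>UNIV. E y $ k $ d * dE k y $ l $ e))"
    for d e
  have B: "d\<theta> i y $ c $ j = - (\<Sum>d\<in>UNIV. \<Sum>e\<in>UNIV. B d e * \<theta> y $ d $ i * \<theta> y $ e $ j)" for i j
  proof -
    have "(\<theta> y ** dE i y) $ c $ e = (\<Sum>d\<in>UNIV. B d e * \<theta> y $ d $ i)" for e
    proof -
      have "(\<theta> y ** dE i y) $ c $ e = (\<Sum>l\<in>UNIV. \<theta> y $ c $ l *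
          (\<Sum>d\<in>UNIV. \<theta> y $ d $ i * (\<Sum>k\<in>UNIV. E y $ k $ d * dE k y $ l $ e)))"
        by (simp add: frame_components[OF assms] matrix_matrix_mult_def)
      also have "\<dots> = (\<Sum>d\<in>UNIV. B d e * \<theta> y $ d $ i)"
        unfolding B_def sum_distrib_left sum_distrib_right
        by (subst sum.swap) (simp add: mult_ac)
      finally show ?thesis .
    qed
    then have "d\<theta> i y $ c $ j = - (\<Sum>e\<in>UNIV. \<Sum>d\<in>UNIV. B d e * \<theta> y $ d $ i * \<theta> y $ e $ j)"
      unfolding d\<theta>_def
      by (simp add: matrix_matrix_mult_def[of "_ ** _" "\<theta> y"] sum_distrib_right)
    then show ?thesis by (subst sum.swap)
  qed
  have anti: "B d e - B e d = \<gamma> c e d y - \<gamma> c d e y" for d e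
  proof -
    have "B d e - B e d = (\<Sum>l\<in>UNIV. \<theta> y $ c $ l * (\<Sum>a\<in>UNIV. (\<gamma> a e d y - \<gamma> a d e y) * E y $ l $ a))"
      unfolding B_def torsion_free[OF assms, symmetric]
      by (simp add: sum_subtractf right_diff_distrib)
    also have "\<dots> = (\<Sum>a\<in>UNIV. (\<gamma> a e d y - \<gamma> a d e y) * (\<Sum>l\<in>UNIV. \<theta> y $ c $ l * E y $ l $ a))"
      unfolding sum_distrib_left by (subst sum.swap) (simp add: mult_ac)
    also have "\<dots> = \<gamma> c e d y - \<gamma> c d e y"
      by (simp add: dual_sum[OF assms] if_distrib cong: if_cong)
    finally show ?thesis .
  qed
  have "d\<theta> i y $ c $ j - d\<theta> j y $ c $ i =
      (\<Sum>d\<in>UNIV. \<Sum>e\<in>UNIV. - (B d e - B e d) * \<theta> y $ d $ i * \<theta> y $ e $ j)"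
  proof -
    have "d\<theta> j y $ c $ i = - (\<Sum>d\<in>UNIV. \<Sum>e\<in>UNIV. B e d * \<theta> y $ d $ i * \<theta> y $ e $ j)"
      unfolding B by (subst sum.swap) (simp add: mult_ac)
    then show ?thesis
      unfolding B by (simp add: sum_subtractf left_diff_distrib)
  qed
  then show ?thesis
    unfolding anti by simp
qed

text \<open>The second structure equation in components. The derivatives of \<open>\<theta>\<close>
  inside \<open>d\<omega>\<close> enter antisymmetrised, so \<open>d\<theta>_alt\<close> turns them
  into the bracket term of \<open>R\<close>.\<close>

lemma \<Omega>_eq:
  assumes "y \<in> S"
  shows "\<Omega> i j y $ a $ b = (\<Sum>c\<in>UNIV. \<Sum>d\<in>UNIV. R a b c d y * \<theta> y $ c $ i * \<theta> y $ d $ j)"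
proof -
  let ?t = "\<lambda>c d. \<theta> y $ c $ i * \<theta> y $ d $ j"
  have w: "(\<omega> i y ** \<omega> j y) $ a $ b =
      (\<Sum>c\<in>UNIV. \<Sum>d\<in>UNIV. (\<Sum>e\<in>UNIV. \<gamma> a e c y * \<gamma> e b d y) * (\<theta> y $ c $ i * \<theta> y $ d $ j))" for i j
  proof -
    have "(\<omega> i y ** \<omega> j y) $ a $ b = (\<Sum>e\<in>UNIV. \<Sum>c\<in>UNIV. \<Sum>d\<in>UNIV.
        (\<gamma> a e c y * \<gamma> e b d y) * (\<theta> y $ c $ i * \<theta> y $ d $ j))"
      by (simp add: matrix_matrix_mult_def \<omega>_def sum_product mult_ac)
    also have "\<dots> = (\<Sum>c\<in>UNIV. \<Sum>d\<in>UNIV. \<Sum>e\<in>UNIV.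
        (\<gamma> a e c y * \<gamma> e b d y) * (\<theta> y $ c $ i * \<theta> y $ d $ j))"
      by (subst sum.swap) (intro sum.cong refl sum.swap)
    finally show ?thesis by (simp add: sum_distrib_right)
  qed
  have w': "(\<omega> j y ** \<omega> i y) $ a $ b =
      (\<Sum>c\<in>UNIV. \<Sum>d\<in>UNIV. (\<Sum>e\<in>UNIV. \<gamma> a e d y * \<gamma> e b c y) * ?t c d)"
    unfolding w by (subst sum.swap) (simp add: mult.commute)
  have d: "d\<omega> i j y $ a $ b - d\<omega> j i y $ a $ b =
      (\<Sum>c\<in>UNIV. \<Sum>d\<in>UNIV. (d\<gamma> c a b d y - d\<gamma> d a b c y) * ?t c d) +
      (\<Sum>e\<in>UNIV. \<gamma> a b e y * (d\<theta> i y $ e $ j - d\<theta> j y $ e $ i))"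
  proof -
    have 1: "(\<Sum>c\<in>UNIV. (\<Sum>d\<in>UNIV. \<theta> y $ d $ i * d\<gamma> d a b c y) * \<theta> y $ c $ j) =
        (\<Sum>c\<in>UNIV. \<Sum>d\<in>UNIV. d\<gamma> c a b d y * ?t c d)"
      unfolding sum_distrib_right by (subst sum.swap) (simp add: mult_ac)
    have 2: "(\<Sum>c\<in>UNIV. (\<Sum>d\<in>UNIV. \<theta> y $ d $ j * d\<gamma> d a b c y) * \<theta> y $ c $ i) =
        (\<Sum>c\<in>UNIV. \<Sum>d\<in>UNIV. d\<gamma> d a b c y * ?t c d)"
      unfolding sum_distrib_right by (simp add: mult_ac)
    show ?thesis
      unfolding d\<omega>_def
      by (simp add: sum.distrib 1 2 sum_subtractf left_diff_distrib right_diff_distrib)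
  qed
  have t: "(\<Sum>e\<in>UNIV. \<gamma> a b e y * (d\<theta> i y $ e $ j - d\<theta> j y $ e $ i)) =
      (\<Sum>c\<in>UNIV. \<Sum>d\<in>UNIV. (\<Sum>e\<in>UNIV. \<gamma> a b e y * (\<gamma> e c d y - \<gamma> e d c y)) * ?t c d)"
  proof -
    have "(\<Sum>e\<in>UNIV. \<gamma> a b e y * (d\<theta> i y $ e $ j - d\<theta> j y $ e $ i)) =
        (\<Sum>e\<in>UNIV. \<Sum>c\<in>UNIV. \<Sum>d\<in>UNIV. \<gamma> a b e y * (\<gamma> e c d y - \<gamma> e d c y) * ?t c d)"
      unfolding d\<theta>_alt[OF assms] by (simp add: sum_distrib_left mult.assoc)
    also have "\<dots> = (\<Sum>c\<in>UNIV. \<Sum>d\<in>UNIV. \<Sum>e\<in>UNIV. \<gamma> a b e y * (\<gamma> e c d y - \<gamma> e d c y) * ?t c d)"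
      by (subst sum.swap) (intro sum.cong refl sum.swap)
    finally show ?thesis by (simp add: sum_distrib_right)
  qed
  show ?thesis
    unfolding \<Omega>_def R_def
    by (simp add: d t w[of i j] w' sum.distrib sum_subtractf left_diff_distrib distrib_right
        mult.assoc)
qed

text \<open>The products are nested to the right to match the pattern of
  \<open>tensor_contract\<close>.\<close>

lemma riemann_low_eq:
  assumes "y \<in> S"
  shows "riemann_low g p s i j y = (\<Sum>a\<in>UNIV. \<Sum>b\<in>UNIV. \<Sum>c\<in>UNIV. \<Sum>d\<in>UNIV.
    \<theta> y $ a $ p * (\<theta> y $ b $ s * (\<theta> y $ c $ i * (\<theta> y $ d $ j * (h a y * R a b c d y)))))"
proof -
  have "riemann_low g p s i j y = (g y ** (E y ** \<Omega> i j y ** \<theta> y)) $ p $ s"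
    unfolding riemann_low_def riemann_eq_\<Omega>[OF assms] by (simp add: matrix_matrix_mult_def)
  also have "g y ** (E y ** \<Omega> i j y ** \<theta> y) =
      transpose (\<theta> y) ** H y ** (\<theta> y ** E y) ** \<Omega> i j y ** \<theta> y"
    unfolding g_eq[OF assms] by (simp only: matrix_mul_assoc)
  also have "\<dots> = transpose (\<theta> y) ** (H y ** \<Omega> i j y ** \<theta> y)"
    unfolding dual[OF assms] by (simp add: matrix_mul_assoc)
  finally have "riemann_low g p s i j y =
      (\<Sum>a\<in>UNIV. \<theta> y $ a $ p * (\<Sum>b\<in>UNIV. (H y ** \<Omega> i j y) $ a $ b * \<theta> y $ b $ s))"
    unfolding matrix_mult_component[of "transpose _"] matrix_mult_component[of "_ ** _"]
    by (simp add: transpose_def)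
  moreover have "(H y ** \<Omega> i j y) $ a $ b = h a y * \<Omega> i j y $ a $ b" for a b
  proof -
    have "(H y ** \<Omega> i j y) $ a $ b = (\<Sum>k\<in>UNIV. if k = a then h a y * \<Omega> i j y $ a $ b else 0)"
      unfolding H_def matrix_matrix_mult_def vec_lambda_beta by (intro sum.cong refl) auto
    then show ?thesis by simp
  qed
  ultimately show ?thesis
    unfolding \<Omega>_eq[OF assms] by (simp add: sum_distrib_left sum_distrib_right mult_ac)
qed

lemma g_component:
  "y \<in> S \<Longrightarrow> g y $ i $ j = (\<Sum>a\<in>UNIV. h a y * \<theta> y $ a $ i * \<theta> y $ a $ j)"
  by (simp add: metric_eq transpose_diag_component)

lemma ricci_eq:
  assumes "y \<in> S"
  shows "ricci g i j y = (\<Sum>b\<in>UNIV. \<Sum>d\<in>UNIV. (\<Sum>a\<in>UNIV. R a b a d y) * \<theta> y $ b $ i * \<theta> y $ d $ j)"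
proof -
  let ?X = "\<lambda>b d a c. R a b c d y * \<theta> y $ b $ i * \<theta> y $ d $ j"
  have "riemann g p i p j y = (\<Sum>b\<in>UNIV. \<Sum>a\<in>UNIV. \<Sum>c\<in>UNIV. \<Sum>d\<in>UNIV.
      ?X b d a c * (\<theta> y $ c $ p * E y $ p $ a))" for p
    unfolding riemann_eq_\<Omega>[OF assms] matrix_mult_component[of "_ ** _"]
      matrix_mult_component[of "E y"]
    by (simp add: \<Omega>_eq[OF assms] sum_distrib_left sum_distrib_right mult_ac)
  then have "ricci g i j y = (\<Sum>p\<in>UNIV. \<Sum>b\<in>UNIV. \<Sum>a\<in>UNIV. \<Sum>c\<in>UNIV. \<Sum>d\<in>UNIV.
      ?X b d a c * (\<theta> y $ c $ p * E y $ p $ a))"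
    unfolding ricci_def by simp
  also have "\<dots> = (\<Sum>b\<in>UNIV. \<Sum>a\<in>UNIV. \<Sum>c\<in>UNIV. \<Sum>d\<in>UNIV. \<Sum>p\<in>UNIV.
      ?X b d a c * (\<theta> y $ c $ p * E y $ p $ a))"
    by (rule sum_swap_inner)
  also have "\<dots> = (\<Sum>b\<in>UNIV. \<Sum>a\<in>UNIV. \<Sum>d\<in>UNIV. ?X b d a a)"
  proof -
    have "(\<Sum>c\<in>UNIV. \<Sum>d\<in>UNIV. ?X b d a c * (if c = a then 1 else 0)) =
        (\<Sum>d\<in>UNIV. ?X b d a a)" for a b
      by (subst sum.swap) (simp only: sum_mult_delta mult_1_right)
    then show ?thesis
      unfolding sum_distrib_left[symmetric] dual_sum[OF assms] by (simp only:)
  qed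
  also have "\<dots> = (\<Sum>b\<in>UNIV. \<Sum>d\<in>UNIV. \<Sum>a\<in>UNIV. ?X b d a a)"
    by (intro sum.cong refl sum.swap)
  finally show ?thesis by (simp add: sum_distrib_right)
qed

end

section \<open>Tensors of rank four and Einstein metrics\<close>

lemma sum_swap4:
  fixes X :: "'a \<Rightarrow> 'b \<Rightarrow> 'c \<Rightarrow> 'd \<Rightarrow> 'e \<Rightarrow> 'f \<Rightarrow> 'g \<Rightarrow> 'h \<Rightarrow> real"
  shows "(\<Sum>p\<in>P. \<Sum>q\<in>Q. \<Sum>r\<in>U. \<Sum>s\<in>V. \<Sum>a\<in>A. \<Sum>b\<in>B. \<Sum>c\<in>C. \<Sum>d\<in>D. X p q r s a b c d) =
    (\<Sum>a\<in>A. \<Sum>b\<in>B. \<Sum>c\<in>C. \<Sum>d\<in>D. \<Sum>p\<in>P. \<Sum>q\<in>Q. \<Sum>r\<in>U. \<Sum>s\<in>V. X p q r s a b c d)"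
proof -
  have "(\<Sum>p\<in>P. \<Sum>q\<in>Q. \<Sum>r\<in>U. \<Sum>s\<in>V. Y p q r s) =
      (\<Sum>z\<in>P \<times> Q \<times> U \<times> V. Y (fst z) (fst (snd z)) (fst (snd (snd z))) (snd (snd (snd z))))"
    for Y :: "'a \<Rightarrow> 'b \<Rightarrow> 'c \<Rightarrow> 'd \<Rightarrow> real"
    by (simp add: sum.cartesian_product split_def)
  moreover have "(\<Sum>p\<in>A. \<Sum>q\<in>B. \<Sum>r\<in>C. \<Sum>s\<in>D. Y p q r s) =
      (\<Sum>z\<in>A \<times> B \<times> C \<times> D. Y (fst z) (fst (snd z)) (fst (snd (snd z))) (snd (snd (snd z))))"
    for Y :: "'e \<Rightarrow> 'f \<Rightarrow> 'g \<Rightarrow> 'h \<Rightarrow> real"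
    by (simp add: sum.cartesian_product split_def)
  ultimately show ?thesis
    by (simp only:) (rule sum.swap)
qed

text \<open>Contracts a tensor given by frame components with one vector per slot. It serves both
  for raising all indices and for returning from coordinates to the frame.\<close>

lemma tensor_contract:
  fixes m :: "'a :: finite \<Rightarrow> 'a \<Rightarrow> real"
  shows "(\<Sum>p\<in>UNIV. \<Sum>q\<in>UNIV. \<Sum>r\<in>UNIV. \<Sum>s\<in>UNIV. n1 p * (n2 q * (n3 r * (n4 s *
      (\<Sum>a\<in>UNIV. \<Sum>b\<in>UNIV. \<Sum>c\<in>UNIV. \<Sum>d\<in>UNIV. m a p * (m b q * (m c r * (m d s * F a b c d)))))))) =
    (\<Sum>a\<in>UNIV. \<Sum>b\<in>UNIV. \<Sum>c\<in>UNIV. \<Sum>d\<in>UNIV. (\<Sum>p\<in>UNIV. n1 p * m a p) * ((\<Sum>q\<in>UNIV. n2 q * m b q) *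
      ((\<Sum>r\<in>UNIV. n3 r * m c r) * ((\<Sum>s\<in>UNIV. n4 s * m d s) * F a b c d))))" (is "?L = ?R")
proof -
  have "?L = (\<Sum>p\<in>UNIV. \<Sum>q\<in>UNIV. \<Sum>r\<in>UNIV. \<Sum>s\<in>UNIV. \<Sum>a\<in>UNIV. \<Sum>b\<in>UNIV. \<Sum>c\<in>UNIV. \<Sum>d\<in>UNIV.
      n1 p * m a p * (n2 q * m b q * (n3 r * m c r * (n4 s * m d s * F a b c d))))"
    by (simp add: sum_distrib_left mult_ac)
  also have "\<dots> = (\<Sum>a\<in>UNIV. \<Sum>b\<in>UNIV. \<Sum>c\<in>UNIV. \<Sum>d\<in>UNIV. \<Sum>p\<in>UNIV. \<Sum>q\<in>UNIV. \<Sum>r\<in>UNIV. \<Sum>s\<in>UNIV.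
      n1 p * m a p * (n2 q * m b q * (n3 r * m c r * (n4 s * m d s * F a b c d))))"
    by (rule sum_swap4)
  also have "\<dots> = ?R"
    by (simp only: sum_distrib_left[symmetric] sum_distrib_right[symmetric])
  finally show ?thesis .
qed

text \<open>Since \<open>C\<close> is trace-free, the first assumption makes the metric an Einstein metric with Ricci
  tensor \<open>3 \<kappa> g\<close> and identifies \<open>C\<close> with its Weyl tensor.\<close>

locale einstein_frame = orthogonal_frame +
  fixes C :: "4 \<Rightarrow> 4 \<Rightarrow> 4 \<Rightarrow> 4 \<Rightarrow> real^4 \<Rightarrow> real" and \<kappa> :: real
  assumes curvature: "y \<in> S \<Longrightarrow> h a y * R a b c d y =
      C a b c d y + \<kappa> * ((if c = a then h a y else 0) * (if d = b then h b y else 0)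
        - (if d = a then h a y else 0) * (if c = b then h b y else 0))"
    and trace_free: "y \<in> S \<Longrightarrow> (\<Sum>a\<in>UNIV. C a b a d y / h a y) = 0"
begin

text \<open>\<open>C\<close> has no trace, and the trace of the \<open>\<kappa>\<close> part is
  \<open>4 - 1 = 3\<close> times \<open>\<kappa> * h\<close>.\<close>

lemma ricci_einstein:
  assumes "y \<in> S"
  shows "ricci g i j y = 3 * \<kappa> * g y $ i $ j"
proof -
  have "(\<Sum>a\<in>UNIV. R a b a d y) = (if d = b then 3 * \<kappa> * h b y else 0)" for b d
  proof -
    have "R a b a d y = C a b a d y / h a y + \<kappa> * (if d = b then h b y else 0)
        - (if a = b then (if d = b then \<kappa> * h b y else 0) else 0)" for a
    proof -
      have "R a b a d y = (h a y * R a b a d y) / h a y"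
        using h_nonzero[OF assms] by simp
      then show ?thesis
        unfolding curvature[OF assms] using h_nonzero[OF assms, of a]
        by (auto simp: field_simps)
    qed
    then show ?thesis
      by (simp add: sum.distrib sum_subtractf trace_free[OF assms])
  qed
  then show ?thesis
    unfolding ricci_eq[OF assms] g_component[OF assms]
    by (simp add: sum_delta_mult mult.assoc sum_distrib_left)
qed

lemma scalar_curvature_einstein:
  assumes "y \<in> S"
  shows "scalar_curvature g y = 12 * \<kappa>"
proof -
  have "scalar_curvature g y = 3 * \<kappa> * (\<Sum>i\<in>UNIV. \<Sum>j\<in>UNIV. inv_metric g y $ i $ j * g y $ j $ i)"
  proof -
    have "g y $ i $ j = g y $ j $ i" for i j
      unfolding g_component[OF assms] by (simp add: mult_ac)
    then have "inv_metric g y $ i $ j * ricci g i j y =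
        3 * \<kappa> * (inv_metric g y $ i $ j * g y $ j $ i)" for i j
      unfolding ricci_einstein[OF assms] by (metis mult.left_commute)
    then show ?thesis
      unfolding scalar_curvature_def by (simp only: sum_distrib_left)
  qed
  moreover have "(\<Sum>j\<in>UNIV. inv_metric g y $ i $ j * g y $ j $ i) = 1" for i
    using inv_metric_eq(2)[OF assms] by (simp add: vec_eq_iff matrix_matrix_mult_def mat_def)
  ultimately show ?thesis by simp
qed

text \<open>With Ricci tensor \<open>3 * \<kappa> * g\<close> and scalar curvature
  \<open>12 * \<kappa>\<close>, the corrections in \<open>weyl\<close> amount to
  \<open>- 3 * \<kappa> + 2 * \<kappa> = - \<kappa>\<close> times the constant curvature tensor,
  which removes exactly the \<open>\<kappa>\<close> part.\<close>

lemma weyl_eq: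
  assumes "y \<in> S"
  shows "weyl g p s i j y = (\<Sum>a\<in>UNIV. \<Sum>b\<in>UNIV. \<Sum>c\<in>UNIV. \<Sum>d\<in>UNIV.
    \<theta> y $ a $ p * (\<theta> y $ b $ s * (\<theta> y $ c $ i * (\<theta> y $ d $ j * C a b c d y))))"
proof -
  let ?T = "\<lambda>F. \<Sum>a\<in>UNIV. \<Sum>b\<in>UNIV. \<Sum>c\<in>UNIV. \<Sum>d\<in>UNIV.
    \<theta> y $ a $ p * (\<theta> y $ b $ s * (\<theta> y $ c $ i * (\<theta> y $ d $ j * F a b c d)))"
  let ?k = "\<lambda>a b. if a = b then h b y else 0"
  have "(\<Sum>c\<in>UNIV. \<Sum>d\<in>UNIV. \<theta> y $ c $ i * (\<theta> y $ d $ j * (?k c a * ?k d b))) =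
      h a y * \<theta> y $ a $ i * (h b y * \<theta> y $ b $ j)" for a b
  proof -
    have "(\<Sum>c\<in>UNIV. \<Sum>d\<in>UNIV. \<theta> y $ c $ i * (\<theta> y $ d $ j * (?k c a * ?k d b))) =
        (\<Sum>c\<in>UNIV. ?k c a * \<theta> y $ c $ i) * (\<Sum>d\<in>UNIV. ?k d b * \<theta> y $ d $ j)"
      by (simp only: sum_product mult_ac)
    then show ?thesis by (simp only: sum_delta_mult)
  qed
  then have "?T (\<lambda>a b c d. ?k c a * ?k d b) = (\<Sum>a\<in>UNIV. \<Sum>b\<in>UNIV.
      (h a y * \<theta> y $ a $ p * \<theta> y $ a $ i) * (h b y * \<theta> y $ b $ s * \<theta> y $ b $ j))"
    by (simp only: sum_distrib_left[symmetric] mult_ac)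
  then have 1: "?T (\<lambda>a b c d. ?k c a * ?k d b) = g y $ p $ i * g y $ s $ j"
    by (simp add: g_component[OF assms] sum_product)
  have "(\<Sum>c\<in>UNIV. \<Sum>d\<in>UNIV. \<theta> y $ c $ i * (\<theta> y $ d $ j * (?k d a * ?k c b))) =
      h a y * \<theta> y $ a $ j * (h b y * \<theta> y $ b $ i)" for a b
  proof -
    have "(\<Sum>c\<in>UNIV. \<Sum>d\<in>UNIV. \<theta> y $ c $ i * (\<theta> y $ d $ j * (?k d a * ?k c b))) =
        (\<Sum>c\<in>UNIV. ?k c b * \<theta> y $ c $ i) * (\<Sum>d\<in>UNIV. ?k d a * \<theta> y $ d $ j)"
      by (simp only: sum_product mult_ac)
    then show ?thesis unfolding sum_delta_mult by (simp only: mult_ac)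
  qed
  then have "?T (\<lambda>a b c d. ?k d a * ?k c b) = (\<Sum>a\<in>UNIV. \<Sum>b\<in>UNIV.
      (h a y * \<theta> y $ a $ p * \<theta> y $ a $ j) * (h b y * \<theta> y $ b $ s * \<theta> y $ b $ i))"
    by (simp only: sum_distrib_left[symmetric] mult_ac)
  then have 2: "?T (\<lambda>a b c d. ?k d a * ?k c b) = g y $ p $ j * g y $ s $ i"
    by (simp add: g_component[OF assms] sum_product)
  have "riemann_low g p s i j y = ?T (\<lambda>a b c d. C a b c d y) +
      \<kappa> * (?T (\<lambda>a b c d. ?k c a * ?k d b) - ?T (\<lambda>a b c d. ?k d a * ?k c b))"
    unfolding riemann_low_eq[OF assms] curvature[OF assms]
    by (simp only: distrib_left right_diff_distrib sum.distrib sum_subtractf sum_distrib_left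
        mult.left_commute[of _ \<kappa>])
  then show ?thesis
    unfolding weyl_def ricci_einstein[OF assms] scalar_curvature_einstein[OF assms] 1 2
    by (simp add: algebra_simps)
qed

lemma inv_metric_\<theta>:
  assumes "y \<in> S"
  shows "(\<Sum>p\<in>UNIV. inv_metric g y $ i $ p * \<theta> y $ a $ p) = E y $ i $ a / h a y"
proof -
  have "(\<Sum>p\<in>UNIV. inv_metric g y $ i $ p * \<theta> y $ a $ p) =
      (\<Sum>p\<in>UNIV. \<Sum>b\<in>UNIV. E y $ i $ b / h b y * (\<theta> y $ a $ p * E y $ p $ b))"
    unfolding inv_metric_eq(1)[OF assms]
    by (simp add: sum_distrib_left sum_distrib_right mult_ac)
  also have "\<dots> = (\<Sum>b\<in>UNIV. E y $ i $ b / h b y * (if b = a then 1 else 0))"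
    by (subst sum.swap)
      (simp only: sum_distrib_left[symmetric] dual_sum[OF assms] eq_commute[of a])
  finally show ?thesis by (simp only: sum_mult_delta mult_1_right)
qed

text \<open>In an orthogonal frame, raising an index is division by the squared length belonging to
  it.\<close>

lemma weyl_square_eq:
  assumes "y \<in> S"
  shows "weyl_square g y = (\<Sum>a\<in>UNIV. \<Sum>b\<in>UNIV. \<Sum>c\<in>UNIV. \<Sum>d\<in>UNIV.
    (C a b c d y)\<^sup>2 / (h a y * h b y * h c y * h d y))"
proof -
  let ?e = "\<lambda>a i. E y $ i $ a / h a y"
  have up: "weyl_up g i j k l y = (\<Sum>a\<in>UNIV. \<Sum>b\<in>UNIV. \<Sum>c\<in>UNIV. \<Sum>d\<in>UNIV.
      ?e a i * (?e b j * (?e c k * (?e d l * C a b c d y))))" for i j k l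
    unfolding weyl_up_def weyl_eq[OF assms] mult.assoc tensor_contract inv_metric_\<theta>[OF assms] ..
  have e: "(\<Sum>i\<in>UNIV. ?e a' i * \<theta> y $ a $ i) = (if a = a' then 1 / h a' y else 0)" for a a'
  proof -
    have "(\<Sum>i\<in>UNIV. ?e a' i * \<theta> y $ a $ i) = (\<Sum>i\<in>UNIV. \<theta> y $ a $ i * E y $ i $ a') / h a' y"
      by (simp add: sum_divide_distrib mult.commute)
    then show ?thesis by (simp add: dual_sum[OF assms])
  qed
  have "weyl_square g y = (\<Sum>i\<in>UNIV. \<Sum>j\<in>UNIV. \<Sum>k\<in>UNIV. \<Sum>l\<in>UNIV.
      \<Sum>a\<in>UNIV. \<Sum>b\<in>UNIV. \<Sum>c\<in>UNIV. \<Sum>d\<in>UNIV.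
        C a b c d y * (?e a i * (?e b j * (?e c k * (?e d l * weyl g i j k l y)))))"
    unfolding weyl_square_def up sum_distrib_left
    by (simp only: mult_ac)
  also have "\<dots> = (\<Sum>a\<in>UNIV. \<Sum>b\<in>UNIV. \<Sum>c\<in>UNIV. \<Sum>d\<in>UNIV.
      \<Sum>i\<in>UNIV. \<Sum>j\<in>UNIV. \<Sum>k\<in>UNIV. \<Sum>l\<in>UNIV.
        C a b c d y * (?e a i * (?e b j * (?e c k * (?e d l * weyl g i j k l y)))))"
    by (rule sum_swap4)
  also have "\<dots> = (\<Sum>a\<in>UNIV. \<Sum>b\<in>UNIV. \<Sum>c\<in>UNIV. \<Sum>d\<in>UNIV. C a b c d y *
      (1 / h a y * (1 / h b y * (1 / h c y * (1 / h d y * C a b c d y)))))"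
  proof -
    have "(\<Sum>i\<in>UNIV. \<Sum>j\<in>UNIV. \<Sum>k\<in>UNIV. \<Sum>l\<in>UNIV.
        ?e a i * (?e b j * (?e c k * (?e d l * weyl g i j k l y)))) =
        1 / h a y * (1 / h b y * (1 / h c y * (1 / h d y * C a b c d y)))" for a b c d
      unfolding weyl_eq[OF assms] tensor_contract e
      by (simp only: sum_distrib_left[symmetric] sum_delta_mult)
    then show ?thesis
      by (simp only: sum_distrib_left[symmetric, of "C _ _ _ _ y"])
  qed
  finally show ?thesis
    by (simp add: power2_eq_square mult_ac)
qed

text \<open>Here \<open>w a\<close> is the derivative of the Weyl square along \<open>e_a\<close>,
  so the sum is the squared norm of the gradient; the sign in \<open>k_covector\<close> squares
  away.\<close>

lemma I5_eq:
  assumes "y \<in> S"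
    and W: "\<And>z. z \<in> S \<Longrightarrow> weyl_square g z = W z"
    and dW: "\<And>i. has_partial i W (\<Sum>a\<in>UNIV. \<theta> y $ a $ i * w a) y"
  shows "I5 g y = (\<Sum>a\<in>UNIV. (w a)\<^sup>2 / h a y)"
proof -
  have "has_partial i (weyl_square g) (\<Sum>a\<in>UNIV. \<theta> y $ a $ i * w a) y" for i
    by (rule has_partial_transform[OF dW open_S assms(1)]) (simp add: W)
  then have k: "k_covector g i y = - (\<Sum>a\<in>UNIV. \<theta> y $ a $ i * w a)" for i
    unfolding k_covector_def using has_partial_imp_partial_deriv by metis
  have raise: "(\<Sum>j\<in>UNIV. inv_metric g y $ i $ j * k_covector g j y) =
      - (\<Sum>a\<in>UNIV. E y $ i $ a / h a y * w a)" for i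
  proof -
    have "(\<Sum>j\<in>UNIV. inv_metric g y $ i $ j * k_covector g j y) =
        - (\<Sum>j\<in>UNIV. \<Sum>a\<in>UNIV. inv_metric g y $ i $ j * \<theta> y $ a $ j * w a)"
      unfolding k by (simp add: sum_distrib_left sum_negf mult_ac)
    also have "\<dots> = - (\<Sum>a\<in>UNIV. (\<Sum>j\<in>UNIV. inv_metric g y $ i $ j * \<theta> y $ a $ j) * w a)"
      unfolding sum_distrib_right by (subst sum.swap) simp
    finally show ?thesis by (simp add: inv_metric_\<theta>[OF assms(1)])
  qed
  have frame: "(\<Sum>i\<in>UNIV. E y $ i $ a * k_covector g i y) = - w a" for a
  proof -
    have "(\<Sum>i\<in>UNIV. E y $ i $ a * k_covector g i y) =
        - (\<Sum>i\<in>UNIV. \<Sum>b\<in>UNIV. (\<theta> y $ b $ i * E y $ i $ a) * w b)"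
      unfolding k by (simp add: sum_distrib_left sum_negf mult_ac)
    also have "\<dots> = - (\<Sum>b\<in>UNIV. (\<Sum>i\<in>UNIV. \<theta> y $ b $ i * E y $ i $ a) * w b)"
      unfolding sum_distrib_right by (subst sum.swap) simp
    finally show ?thesis by (simp add: dual_sum[OF assms(1)] sum_delta_mult)
  qed
  have "I5 g y = (\<Sum>i\<in>UNIV. k_covector g i y * (\<Sum>j\<in>UNIV. inv_metric g y $ i $ j * k_covector g j y))"
    unfolding I5_def by (simp add: sum_distrib_left mult_ac)
  also have "\<dots> = - (\<Sum>i\<in>UNIV. \<Sum>a\<in>UNIV. w a / h a y * (E y $ i $ a * k_covector g i y))"
    unfolding raise by (simp add: sum_distrib_left sum_negf mult_ac)
  also have "\<dots> = - (\<Sum>a\<in>UNIV. w a / h a y * (\<Sum>i\<in>UNIV. E y $ i $ a * k_covector g i y))"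
    unfolding sum_distrib_left by (subst sum.swap) simp
  also have "\<dots> = (\<Sum>a\<in>UNIV. (w a)\<^sup>2 / h a y)"
    unfolding frame by (simp add: power2_eq_square sum_negf)
  finally show ?thesis .
qed

end

section \<open>The Kerr-(anti-)de Sitter frame\<close>

lemma vector_4 [simp]:
  "(vector [x, y, z, w] :: 'a::zero^4) $ 1 = x"
  "(vector [x, y, z, w] :: 'a::zero^4) $ 2 = y"
  "(vector [x, y, z, w] :: 'a::zero^4) $ 3 = z"
  "(vector [x, y, z, w] :: 'a::zero^4) $ 4 = w"
  unfolding vector_def by simp_all

text \<open>The entry \<open>$ A $ B $ C\<close> is the component along \<open>e\<^sub>A\<close> of the covariant derivative of \<open>e\<^sub>B\<close>
  along \<open>e\<^sub>C\<close>, as given by Koszul's formula. Every entry is linear in the last six arguments, so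
  derivatives of the connection coefficients are again values of \<open>conn\<close>.\<close>

definition conn :: "real \<Rightarrow> real \<Rightarrow> real \<Rightarrow> real \<Rightarrow> real \<Rightarrow> real \<Rightarrow> real \<Rightarrow> real^4^4^4" where
  "conn a q x f k g l = vector [
    vector [vector [0, q + f, a * l, 0],
      vector [q - f, 0, 0, a * g],
      vector [a * l, 0, 0, - l],
      vector [0, a * g, l, 0]],
    vector [vector [q - f, 0, 0, a * g],
      vector [0, q + f, a * l, 0],
      vector [0, a * l, - g, 0],
      vector [a * g, 0, 0, - g]],
    vector [vector [a * k, 0, 0, - k],
      vector [0, - a * k, f, 0],
      vector [0, f, a * l + x, 0],
      vector [- k, 0, 0, a * l - x]],
    vector [vector [0, a * f, k, 0],
      vector [- a * f, 0, 0, f],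
      vector [k, 0, 0, x - a * l],
      vector [0, f, x + a * l, 0]]]"

lemma conn_deriv:
  assumes "(q has_real_derivative q') (at t)" "(x has_real_derivative x') (at t)"
    "(f has_real_derivative f') (at t)" "(k has_real_derivative k') (at t)"
    "(g has_real_derivative g') (at t)" "(l has_real_derivative l') (at t)"
  shows "((\<lambda>t. conn a (q t) (x t) (f t) (k t) (g t) (l t) $ A $ B $ C) has_real_derivative
    conn a q' x' f' k' g' l' $ A $ B $ C) (at t)"
proof -
  note [derivative_intros] = assms
  have "\<forall>A B C. ((\<lambda>t. conn a (q t) (x t) (f t) (k t) (g t) (l t) $ A $ B $ C) has_real_derivative
    conn a q' x' f' k' g' l' $ A $ B $ C) (at t)"
    unfolding forall_4 conn_def vector_4
    by (intro conjI) (auto intro!: derivative_eq_intros)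
  then show ?thesis by blast
qed

section \<open>Curvature as polynomials in \<open>r\<close> and \<open>c\<close>\<close>

locale kerr_parameters =
  fixes a m \<Lambda> :: real
  assumes Xi_nonzero: "Xi a \<Lambda> \<noteq> 0"
begin

definition \<kappa> :: real where
  "\<kappa> = \<Lambda> / 3"

definition Q :: "real \<Rightarrow> real" where
  "Q r = a^2 - 2 * m * r + (1 - a^2 * \<kappa>) * r^2 - \<kappa> * r^4"

text \<open>The polar counterpart of \<open>Q\<close>: at \<open>c = cos \<theta>\<close> it equals
  \<open>Delta_theta\<close> times the squared sine.\<close>

definition X :: "real \<Rightarrow> real" where
  "X c = (1 - c^2) * (1 + a^2 * \<kappa> * c^2)"

text \<open>\<open>q\<close> and \<open>x\<close> are half the derivatives of \<open>Q\<close> and \<open>X\<close>.\<close>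

definition q :: "real \<Rightarrow> real" where
  "q r = - m + (1 - a^2 * \<kappa>) * r - 2 * \<kappa> * r^3"

definition q' :: "real \<Rightarrow> real" where
  "q' r = 1 - a^2 * \<kappa> - 6 * \<kappa> * r^2"

definition x :: "real \<Rightarrow> real" where
  "x c = (a^2 * \<kappa> - 1) * c - 2 * a^2 * \<kappa> * c^3"

definition x' :: "real \<Rightarrow> real" where
  "x' c = a^2 * \<kappa> - 1 - 6 * a^2 * \<kappa> * c^2"

definition \<rho> :: "real \<Rightarrow> real \<Rightarrow> real" where
  "\<rho> r c = r^2 + a^2 * c^2"

lemma Q_deriv: "(Q has_real_derivative 2 * q r) (at r)"
  unfolding Q_def [abs_def] q_def by (auto intro!: derivative_eq_intros simp: algebra_simps)

lemma q_deriv: "(q has_real_derivative q' r) (at r)"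
  unfolding q_def [abs_def] q'_def by (auto intro!: derivative_eq_intros simp: algebra_simps)

lemma X_deriv: "(X has_real_derivative 2 * x c) (at c)"
  unfolding X_def [abs_def] x_def
  by (auto intro!: derivative_eq_intros simp: algebra_simps power2_eq_square power3_eq_cube)

lemma x_deriv: "(x has_real_derivative x' c) (at c)"
  unfolding x_def [abs_def] x'_def by (auto intro!: derivative_eq_intros simp: algebra_simps)

text \<open>The connection coefficients are \<open>nabla A B C / \<rho>\<close>, and the squared lengths of the frame
  vectors are \<open>hh A * \<rho>\<close>.\<close>

definition hh :: "4 \<Rightarrow> real \<Rightarrow> real \<Rightarrow> real" where
  "hh A r c = (vector [- Q r, Q r, X c, X c] :: real^4) $ A"

definition nabla :: "4 \<Rightarrow> 4 \<Rightarrow> 4 \<Rightarrow> real \<Rightarrow> real \<Rightarrow> real" where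
  "nabla A B C r c = conn a (q r * \<rho> r c) (x c * \<rho> r c) (r * Q r) (a * c * Q r)
     (r * X c) (a * c * X c) $ A $ B $ C"

definition nabla_r :: "4 \<Rightarrow> 4 \<Rightarrow> 4 \<Rightarrow> real \<Rightarrow> real \<Rightarrow> real" where
  "nabla_r A B C r c = conn a (q' r * \<rho> r c + 2 * r * q r) (2 * r * x c) (Q r + 2 * r * q r)
     (2 * a * c * q r) (X c) 0 $ A $ B $ C"

definition nabla_c :: "4 \<Rightarrow> 4 \<Rightarrow> 4 \<Rightarrow> real \<Rightarrow> real \<Rightarrow> real" where
  "nabla_c A B C r c = conn a (2 * a^2 * c * q r) (x' c * \<rho> r c + 2 * a^2 * c * x c) 0
     (a * Q r) (2 * r * x c) (a * (X c + 2 * c * x c)) $ A $ B $ C"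

text \<open>This is \<open>\<rho>^2\<close> times the derivative of the connection coefficients along the frame vector \<open>e\<^sub>D\<close>.\<close>

definition dnabla :: "4 \<Rightarrow> 4 \<Rightarrow> 4 \<Rightarrow> 4 \<Rightarrow> real \<Rightarrow> real \<Rightarrow> real" where
  "dnabla D A B C r c =
    (if D = 2 then Q r * (nabla_r A B C r c * \<rho> r c - 2 * r * nabla A B C r c)
     else if D = 3 then X c * (nabla_c A B C r c * \<rho> r c - 2 * a^2 * c * nabla A B C r c)
     else 0)"

lemma \<rho>_deriv:
  "((\<lambda>r. \<rho> r c) has_real_derivative 2 * r) (at r)"
  "((\<lambda>c. \<rho> r c) has_real_derivative 2 * a^2 * c) (at c)"
  unfolding \<rho>_def by (auto intro!: derivative_eq_intros)

lemma nabla_deriv: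
  "((\<lambda>r. nabla A B C r c) has_real_derivative nabla_r A B C r c) (at r)"
  "((\<lambda>c. nabla A B C r c) has_real_derivative nabla_c A B C r c) (at c)"
proof -
  note [derivative_intros] = Q_deriv q_deriv X_deriv x_deriv \<rho>_deriv
  show "((\<lambda>r. nabla A B C r c) has_real_derivative nabla_r A B C r c) (at r)"
    unfolding nabla_def nabla_r_def
    by (rule conn_deriv) (auto intro!: derivative_eq_intros)
  show "((\<lambda>c. nabla A B C r c) has_real_derivative nabla_c A B C r c) (at c)"
    unfolding nabla_def nabla_c_def
    by (rule conn_deriv) (auto intro!: derivative_eq_intros simp: algebra_simps)
qed

text \<open>The frame curvature \<open>R\<close> multiplied by \<open>\<rho>^2\<close>, which clears
  all denominators.\<close>

definition riem :: "4 \<Rightarrow> 4 \<Rightarrow> 4 \<Rightarrow> 4 \<Rightarrow> real \<Rightarrow> real \<Rightarrow> real" where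
  "riem A B C D r c = dnabla C A B D r c - dnabla D A B C r c +
     (\<Sum>E\<in>UNIV. nabla A B E r c * (nabla E C D r c - nabla E D C r c)
        + nabla A E C r c * nabla E B D r c - nabla A E D r c * nabla E B C r c)"

text \<open>The ratio \<open>2 : -1 : -1\<close> of type D. The blocks are the planes spanned by
  frame vectors 1, 2 and 3, 4; each index has one partner in its own block and two in the other, so
  the weights cancel in the trace.\<close>

definition weyl_sign :: "4 \<Rightarrow> 4 \<Rightarrow> real" where
  "weyl_sign A B = (if (A \<in> {1, 2}) = (B \<in> {1, 2}) then 2 else - 1)"

text \<open>The Vandermonde product of a permutation of \<open>1, 2, 3, 4\<close> is its sign times \<open>12\<close>.\<close>

definition levi_civita :: "4 \<Rightarrow> 4 \<Rightarrow> 4 \<Rightarrow> 4 \<Rightarrow> real" where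
  "levi_civita A B C D = (let n = (\<lambda>i. (vector [1, 2, 3, 4] :: real^4) $ i) in
     (n B - n A) * (n C - n A) * (n D - n A) * (n C - n B) * (n D - n B) * (n D - n C) / 12)"

definition kronecker :: "4 \<Rightarrow> 4 \<Rightarrow> 4 \<Rightarrow> 4 \<Rightarrow> real" where
  "kronecker A B C D = (if C = A then 1 else 0) * (if D = B then 1 else 0)
    - (if D = A then 1 else 0) * (if C = B then 1 else 0)"

text \<open>Together \<open>m (r + \<i> a c)^3\<close>, which is \<open>- \<rho>^3\<close> times the Weyl scalar \<open>\<Psi>\<^sub>2\<close>, up to conjugation.\<close>

definition weyl_re :: "real \<Rightarrow> real \<Rightarrow> real" where
  "weyl_re r c = m * (r^3 - 3 * r * (a * c)^2)"

definition weyl_im :: "real \<Rightarrow> real \<Rightarrow> real" where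
  "weyl_im r c = m * (3 * r^2 * (a * c) - (a * c)^3)"

text \<open>On bivectors \<open>kronecker\<close> acts as the identity and
  \<open>levi_civita\<close> as the Hodge dual, which plays the part of the imaginary unit; hence
  the real and the imaginary part as their factors. The last line is the constant curvature
  part.\<close>

definition riem_weyl :: "4 \<Rightarrow> 4 \<Rightarrow> 4 \<Rightarrow> 4 \<Rightarrow> real \<Rightarrow> real \<Rightarrow> real" where
  "riem_weyl A B C D r c = weyl_sign A B * (weyl_re r c * (hh A r c * hh B r c * kronecker A B C D)
    + weyl_im r c * (Q r * X c * levi_civita A B C D))
    + \<kappa> * (\<rho> r c)^3 * (hh A r c * hh B r c * kronecker A B C D)"

text \<open>One polynomial identity for each of the 256 index choices; multiplication by
  \<open>hh A\<close> lowers the first index.\<close>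

lemma hh_riem: "hh A r c * riem A B C D r c = riem_weyl A B C D r c"
proof -
  have "\<forall>A B C D. hh A r c * riem A B C D r c = riem_weyl A B C D r c"
    unfolding forall_4
    by (intro conjI;
        simp add: riem_weyl_def riem_def sum_4 dnabla_def nabla_def nabla_r_def nabla_c_def
          weyl_sign_def levi_civita_def kronecker_def hh_def conn_def;
        \<comment> \<open>Simplification may cancel a common factor and leave a disjunction that
          starts with the vanishing of this factor; the cancelled identity is the one
          proved.\<close>
        (intro disjI2)?;
        unfold weyl_re_def weyl_im_def Q_def X_def q_def q'_def x_def x'_def \<rho>_def; algebra)
  then show ?thesis by blast
qed

section \<open>Frame and coframe in the coordinate chart\<close>

definition \<Delta> :: "real \<Rightarrow> real" where
  "\<Delta> t = 1 + a^2 * \<kappa> * (cos t)^2"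

definition \<xi> :: real where
  "\<xi> = Xi a \<Lambda>"

lemma \<xi>_nonzero: "\<xi> \<noteq> 0"
  using Xi_nonzero unfolding \<xi>_def .

lemma X_cos: "X (cos t) = \<Delta> t * (sin t)^2"
  unfolding X_def \<Delta>_def by (simp add: sin_squared_eq mult.commute)

lemma Delta_r_eq: "Delta_r a m \<Lambda> r = Q r"
  unfolding Delta_r_def Q_def \<kappa>_def by (simp add: field_simps power4_eq_xxxx power2_eq_square)

lemma Delta_theta_eq: "Delta_theta a \<Lambda> t = \<Delta> t"
  unfolding Delta_theta_def \<Delta>_def \<kappa>_def by simp

lemma rho2_eq: "rho2 a r t = \<rho> r (cos t)"
  unfolding rho2_def \<rho>_def ..

abbreviation "reg \<equiv> regular_points a m \<Lambda>"

lemma regular: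
  assumes "y \<in> reg"
  shows "Q (y $ 2) \<noteq> 0" "\<Delta> (y $ 3) \<noteq> 0" "\<rho> (y $ 2) (cos (y $ 3)) \<noteq> 0" "sin (y $ 3) \<noteq> 0"
    "X (cos (y $ 3)) \<noteq> 0"
  using assms unfolding regular_points_def X_cos
  by (auto simp: Delta_r_eq Delta_theta_eq rho2_eq)

lemma open_regular: "open reg"
  unfolding regular_points_def Delta_r_def Delta_theta_def rho2_def
  by (intro open_Collect_conj open_Collect_neq continuous_intros)

text \<open>Carter's frame, rescaled so that all components are polynomial in \<open>r\<close>, \<open>sin \<theta>\<close>, \<open>cos \<theta>\<close>.\<close>

definition frame :: "real^4 \<Rightarrow> real^4^4" where
  "frame y = vector [
     vector [\<xi> * ((y $ 2)^2 + a^2), 0, 0, - (\<xi> * a * (sin (y $ 3))^2)],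
     vector [0, Q (y $ 2), 0, 0],
     vector [0, 0, - (\<Delta> (y $ 3) * sin (y $ 3)), 0],
     vector [\<xi> * a, 0, 0, - \<xi>]]"

text \<open>The outer rows are the forms \<open>e0\<close> and \<open>e3\<close> of the metric
  divided by \<open>p\<close>. This absorbs \<open>Xi\<close> and leaves the squared lengths
  \<open>hh A * \<rho>\<close>.\<close>

definition coframe :: "real^4 \<Rightarrow> real^4^4" where
  "coframe y = (let p = \<xi> * \<rho> (y $ 2) (cos (y $ 3)) in vector [
     vector [1 / p, 0, 0, - (a * (sin (y $ 3))^2) / p],
     vector [0, 1 / Q (y $ 2), 0, 0],
     vector [0, 0, - 1 / (\<Delta> (y $ 3) * sin (y $ 3)), 0],
     vector [a / p, 0, 0, - ((y $ 2)^2 + a^2) / p]])"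

definition dframe :: "4 \<Rightarrow> real^4 \<Rightarrow> real^4^4" where
  "dframe i y = (if i = 2 then vector [
       vector [2 * \<xi> * y $ 2, 0, 0, 0], vector [0, 2 * q (y $ 2), 0, 0], 0, 0]
     else if i = 3 then vector [
       vector [0, 0, 0, - (2 * \<xi> * a * sin (y $ 3) * cos (y $ 3))], 0,
       vector [0, 0, 2 * a^2 * \<kappa> * cos (y $ 3) * (sin (y $ 3))^2 - \<Delta> (y $ 3) * cos (y $ 3), 0], 0]
     else 0)"

definition ddframe :: "4 \<Rightarrow> 4 \<Rightarrow> real^4 \<Rightarrow> real^4^4" where
  "ddframe i j y = (if i = 2 \<and> j = 2 then vector [
       vector [2 * \<xi>, 0, 0, 0], vector [0, 2 * q' (y $ 2), 0, 0], 0, 0]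
     else if i = 3 \<and> j = 3 then vector [
       vector [0, 0, 0, - (2 * \<xi> * a * ((cos (y $ 3))^2 - (sin (y $ 3))^2))], 0,
       vector [0, 0, 6 * a^2 * \<kappa> * (cos (y $ 3))^2 * sin (y $ 3) - 2 * a^2 * \<kappa> * (sin (y $ 3))^3
         + \<Delta> (y $ 3) * sin (y $ 3), 0], 0]
     else 0)"

lemma \<Delta>_deriv: "(\<Delta> has_real_derivative - 2 * a^2 * \<kappa> * cos t * sin t) (at t)"
  unfolding \<Delta>_def [abs_def] by (auto intro!: derivative_eq_intros)

lemmas chain_derivs = DERIV_chain2[OF Q_deriv, THEN DERIV_cong]
  DERIV_chain2[OF q_deriv, THEN DERIV_cong] DERIV_chain2[OF \<Delta>_deriv, THEN DERIV_cong]

lemma frame_deriv: "has_matrix_partial i frame (dframe i y) y"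
proof -
  have "\<forall>i p q. has_partial i (\<lambda>y. frame y $ p $ q) (dframe i y $ p $ q) y"
    unfolding forall_4 has_partial_def frame_def dframe_def
    by (simp add: axis_def) (auto intro!: derivative_eq_intros chain_derivs simp: power2_eq_square)
  then show ?thesis
    unfolding has_matrix_partial_def by blast
qed

lemma dframe_deriv: "has_matrix_partial i (dframe j) (ddframe i j y) y"
proof -
  have "\<forall>i j p q. has_partial i (\<lambda>y. dframe j y $ p $ q) (ddframe i j y $ p $ q) y"
    unfolding forall_4 has_partial_def dframe_def ddframe_def
    by (simp add: axis_def)
      (auto intro!: derivative_eq_intros chain_derivs simp: power2_eq_square power3_eq_cube algebra_simps)
  then show ?thesis
    unfolding has_matrix_partial_def by blast
qed

lemma coframe_differentiable:
  assumes "y \<in> reg"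
  shows "\<exists>D. has_matrix_partial i coframe D y"
proof (rule has_matrix_partial_ex)
  note nz = regular[OF assms] \<xi>_nonzero
  have "\<forall>i p q. \<exists>d. has_partial i (\<lambda>y. coframe y $ p $ q) d y"
    unfolding forall_4 has_partial_def coframe_def Let_def \<rho>_def
    using nz
    by (simp add: axis_def \<rho>_def)
      (intro conjI; rule exI; (rule derivative_eq_intros chain_derivs refl)+; simp)
  then show "\<exists>d. has_partial i (\<lambda>y. coframe y $ p $ q) d y" for p q
    by blast
qed

lemma coframe_dual:
  assumes "y \<in> reg"
  shows "coframe y ** frame y = mat 1"
proof -
  have "\<forall>i j. (coframe y ** frame y) $ i $ j = mat 1 $ i $ j"
    unfolding forall_4 matrix_mult_component sum_4 coframe_def frame_def mat_def Let_def
    by (intro conjI; simp add: divide_simps regular[OF assms] \<xi>_nonzero;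
        (unfold \<rho>_def sin_squared_eq)?; algebra)
  then show ?thesis by (simp add: vec_eq_iff)
qed

lemma kerr_ds_frame:
  assumes "y \<in> reg"
  shows "kerr_ds a m \<Lambda> y = transpose (coframe y) **
    (\<chi> A B. if A = B then hh A (y $ 2) (cos (y $ 3)) * \<rho> (y $ 2) (cos (y $ 3)) else 0) ** coframe y"
proof -
  have "\<forall>i j. kerr_ds a m \<Lambda> y $ i $ j = (transpose (coframe y) **
    (\<chi> A B. if A = B then hh A (y $ 2) (cos (y $ 3)) * \<rho> (y $ 2) (cos (y $ 3)) else 0) ** coframe y) $ i $ j"
    using regular[OF assms] \<xi>_nonzero
    unfolding transpose_diag_component forall_4 sum_4 kerr_ds_def coframe_def hh_def Let_def
      Delta_r_eq Delta_theta_eq rho2_eq \<xi>_def[symmetric] X_cos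
    by (simp add: axis_def) (simp add: divide_simps power2_eq_square)
  then show ?thesis by (simp add: vec_eq_iff)
qed

text \<open>On functions of \<open>r\<close> and \<open>c\<close>, frame vector 2 acts as
  \<open>Q\<close> times the derivative in \<open>r\<close> and vector 3 as \<open>X\<close> times
  the derivative in \<open>c\<close>: the minus sign in the frame cancels that of the derivative of
  the cosine. The other two annihilate such functions.\<close>

lemma has_partial_frame:
  assumes "y \<in> reg"
    and "((\<lambda>r. G r (cos (y $ 3))) has_real_derivative Gr) (at (y $ 2))"
    and "((\<lambda>c. G (y $ 2) c) has_real_derivative Gc) (at (cos (y $ 3)))"
  shows "has_partial i (\<lambda>y. G (y $ 2) (cos (y $ 3))) (\<Sum>d\<in>UNIV. coframe y $ d $ i *
    (if d = 2 then Q (y $ 2) * Gr else if d = 3 then X (cos (y $ 3)) * Gc else 0)) y"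
proof -
  have *: "has_partial i (\<lambda>y. G (y $ 2) (cos (y $ 3)))
    (if i = 2 then Gr else if i = 3 then - sin (y $ 3) * Gc else 0) y"
    by (rule has_partial_two[where F = "\<lambda>r t. G r (cos t)"])
      (use assms(2) DERIV_chain2[of "G (y $ 2)" Gc cos "y $ 3", OF assms(3) DERIV_cos] in
        \<open>simp_all add: mult.commute\<close>)
  have "\<forall>i. (if i = 2 then Gr else if i = 3 then - sin (y $ 3) * Gc else 0) =
    (\<Sum>d\<in>UNIV. coframe y $ d $ i *
    (if d = 2 then Q (y $ 2) * Gr else if d = 3 then X (cos (y $ 3)) * Gc else 0))"
    unfolding forall_4 sum_4 coframe_def Let_def X_cos
    using regular[OF assms(1)] by (simp add: power2_eq_square)
  then have "(if i = 2 then Gr else if i = 3 then - sin (y $ 3) * Gc else 0) =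
    (\<Sum>d\<in>UNIV. coframe y $ d $ i *
    (if d = 2 then Q (y $ 2) * Gr else if d = 3 then X (cos (y $ 3)) * Gc else 0))"
    by (rule spec)
  with * show ?thesis by (simp only:)
qed

lemma torsion:
  assumes "y \<in> reg"
  shows "(\<Sum>l\<in>UNIV. frame y $ l $ C * dframe l y $ P $ B - frame y $ l $ B * dframe l y $ P $ C) =
    (\<Sum>A\<in>UNIV. (nabla A B C (y $ 2) (cos (y $ 3)) / \<rho> (y $ 2) (cos (y $ 3))
      - nabla A C B (y $ 2) (cos (y $ 3)) / \<rho> (y $ 2) (cos (y $ 3))) * frame y $ P $ A)"
proof -
  define r c s where "r = y $ 2" and "c = cos (y $ 3)" and "s = sin (y $ 3)"
  define d where "d = \<Delta> (y $ 3)"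
  have s: "s^2 = 1 - c^2" and X: "X c = d * s^2"
    unfolding s_def c_def d_def by (simp_all add: sin_squared_eq X_cos)
  \<comment> \<open>Expresses \<open>x\<close> through \<open>d\<close> and \<open>s\<close>, in
    which \<open>frame\<close> and \<open>dframe\<close> are written. What remains are polynomial
    identities modulo \<open>s^2 = 1 - c^2\<close>.\<close>
  have x: "x c = a^2 * \<kappa> * c * s^2 - d * c"
    unfolding x_def s d_def \<Delta>_def c_def by algebra
  have "\<forall>C P B. \<rho> r c * (\<Sum>l\<in>UNIV. frame y $ l $ C * dframe l y $ P $ B - frame y $ l $ B * dframe l y $ P $ C) =
    (\<Sum>A\<in>UNIV. (nabla A B C r c - nabla A C B r c) * frame y $ P $ A)"
    unfolding forall_4 sum_4 frame_def dframe_def nabla_def conn_def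
      r_def[symmetric] c_def[symmetric] s_def[symmetric] d_def[symmetric]
    by (intro conjI; simp; (unfold x X \<rho>_def)?; insert s; algebra)
  then have "\<rho> r c * (\<Sum>l\<in>UNIV. frame y $ l $ C * dframe l y $ P $ B - frame y $ l $ B * dframe l y $ P $ C) =
    (\<Sum>A\<in>UNIV. (nabla A B C r c - nabla A C B r c) * frame y $ P $ A)" by blast
  then show ?thesis
    using regular(3)[OF assms] unfolding r_def[symmetric] c_def[symmetric]
    by (simp add: diff_divide_distrib[symmetric] sum_divide_distrib[symmetric] nonzero_eq_divide_eq mult.commute)
qed

definition square_r :: "4 \<Rightarrow> real \<Rightarrow> real \<Rightarrow> real" where
  "square_r A r c = (vector [- (2 * q r * \<rho> r c + 2 * r * Q r), 2 * q r * \<rho> r c + 2 * r * Q r,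
     2 * r * X c, 2 * r * X c] :: real^4) $ A"

definition square_c :: "4 \<Rightarrow> real \<Rightarrow> real \<Rightarrow> real" where
  "square_c A r c = (vector [- (2 * a^2 * c * Q r), 2 * a^2 * c * Q r,
     2 * x c * \<rho> r c + 2 * a^2 * c * X c, 2 * x c * \<rho> r c + 2 * a^2 * c * X c] :: real^4) $ A"

lemma square_deriv:
  "((\<lambda>r. hh A r c * \<rho> r c) has_real_derivative square_r A r c) (at r)"
  "((\<lambda>c. hh A r c * \<rho> r c) has_real_derivative square_c A r c) (at c)"
proof -
  note [derivative_intros] = Q_deriv X_deriv \<rho>_deriv
  have "\<forall>A. ((\<lambda>r. hh A r c * \<rho> r c) has_real_derivative square_r A r c) (at r)"
    unfolding forall_4 hh_def square_r_def vector_4 by (auto intro!: derivative_eq_intros)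
  then show "((\<lambda>r. hh A r c * \<rho> r c) has_real_derivative square_r A r c) (at r)" by blast
  have "\<forall>A. ((\<lambda>c. hh A r c * \<rho> r c) has_real_derivative square_c A r c) (at c)"
    unfolding forall_4 hh_def square_c_def vector_4 by (auto intro!: derivative_eq_intros)
  then show "((\<lambda>c. hh A r c * \<rho> r c) has_real_derivative square_c A r c) (at c)" by blast
qed

lemma compatibility:
  "hh A r c * nabla A B C r c + hh B r c * nabla B A C r c = (if A = B then
    (if C = 2 then Q r * square_r A r c else if C = 3 then X c * square_c A r c else 0) else 0)"
proof -
  have "\<forall>A B C. hh A r c * nabla A B C r c + hh B r c * nabla B A C r c = (if A = B then
    (if C = 2 then Q r * square_r A r c else if C = 3 then X c * square_c A r c else 0) else 0)"
    unfolding forall_4 hh_def nabla_def conn_def square_r_def square_c_def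
    by (simp add: algebra_simps power2_eq_square)
  then show ?thesis by blast
qed

definition weyl_comp :: "4 \<Rightarrow> 4 \<Rightarrow> 4 \<Rightarrow> 4 \<Rightarrow> real \<Rightarrow> real \<Rightarrow> real" where
  "weyl_comp A B C D r c = weyl_sign A B * (weyl_re r c * (hh A r c * hh B r c * kronecker A B C D)
    + weyl_im r c * (Q r * X c * levi_civita A B C D)) / \<rho> r c"

text \<open>For \<open>B = D\<close> the weights add up to \<open>2 - 1 - 1\<close>;
  \<open>levi_civita\<close> vanishes on a repeated index.\<close>

lemma weyl_trace:
  assumes "Q r \<noteq> 0" "X c \<noteq> 0" "\<rho> r c \<noteq> 0"
  shows "(\<Sum>A\<in>UNIV. weyl_comp A B A D r c / (hh A r c * \<rho> r c)) = 0"
proof -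
  have "\<forall>B D. (\<Sum>A\<in>UNIV. weyl_comp A B A D r c / (hh A r c * \<rho> r c)) = 0"
    using assms
    unfolding forall_4 sum_4 weyl_comp_def weyl_sign_def kronecker_def levi_civita_def hh_def
    by (simp add: field_simps)
  then show ?thesis by blast
qed

lemma nabla_over_deriv:
  assumes "\<rho> r c \<noteq> 0"
  shows "((\<lambda>r. nabla A B C r c / \<rho> r c) has_real_derivative
      (nabla_r A B C r c * \<rho> r c - 2 * r * nabla A B C r c) / (\<rho> r c)^2) (at r)"
    and "((\<lambda>c. nabla A B C r c / \<rho> r c) has_real_derivative
      (nabla_c A B C r c * \<rho> r c - 2 * a^2 * c * nabla A B C r c) / (\<rho> r c)^2) (at c)"
  using assms
  by (auto intro!: derivative_eq_intros nabla_deriv \<rho>_deriv simp: power2_eq_square algebra_simps)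

sublocale einstein_frame "kerr_ds a m \<Lambda>" reg frame coframe
  "\<lambda>A y. hh A (y $ 2) (cos (y $ 3)) * \<rho> (y $ 2) (cos (y $ 3))"
  "\<lambda>A B C y. nabla A B C (y $ 2) (cos (y $ 3)) / \<rho> (y $ 2) (cos (y $ 3))"
  dframe ddframe
  "\<lambda>D A y. if D = 2 then Q (y $ 2) * square_r A (y $ 2) (cos (y $ 3))
     else if D = 3 then X (cos (y $ 3)) * square_c A (y $ 2) (cos (y $ 3)) else 0"
  "\<lambda>D A B C y. dnabla D A B C (y $ 2) (cos (y $ 3)) / (\<rho> (y $ 2) (cos (y $ 3)))^2"
  "\<lambda>A B C D y. weyl_comp A B C D (y $ 2) (cos (y $ 3))" \<kappa>
proof -
  have hh: "hh A (y $ 2) (cos (y $ 3)) \<noteq> 0" if "y \<in> reg" for A y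
  proof -
    have "\<forall>A. hh A (y $ 2) (cos (y $ 3)) \<noteq> 0"
      unfolding forall_4 hh_def using regular[OF that] by simp
    then show ?thesis by blast
  qed
  interpret orthogonal_frame "kerr_ds a m \<Lambda>" reg frame coframe
    "\<lambda>A y. hh A (y $ 2) (cos (y $ 3)) * \<rho> (y $ 2) (cos (y $ 3))"
    "\<lambda>A B C y. nabla A B C (y $ 2) (cos (y $ 3)) / \<rho> (y $ 2) (cos (y $ 3))"
    dframe ddframe
    "\<lambda>D A y. if D = 2 then Q (y $ 2) * square_r A (y $ 2) (cos (y $ 3))
       else if D = 3 then X (cos (y $ 3)) * square_c A (y $ 2) (cos (y $ 3)) else 0"
    "\<lambda>D A B C y. dnabla D A B C (y $ 2) (cos (y $ 3)) / (\<rho> (y $ 2) (cos (y $ 3)))^2"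
  proof (unfold_locales, goal_cases)
    case 1 show ?case by (rule open_regular)
  next
    case (2 y) then show ?case by (rule kerr_ds_frame)
  next
    case (3 y A) then show ?case using hh regular(3) by simp
  next
    case (4 y) then show ?case by (rule coframe_dual)
  next
    case (5 y i) show ?case by (rule frame_deriv)
  next
    case (6 y j i) show ?case by (rule dframe_deriv)
  next
    case (7 y i j) show ?case unfolding ddframe_def by auto
  next
    case (8 y i) then show ?case by (rule coframe_differentiable)
  next
    case (9 y i A)
    show ?case
      by (rule has_partial_frame[OF 9, where G = "\<lambda>r c. hh A r c * \<rho> r c"]) (rule square_deriv)+
  next
    case (10 y i A B C)
    have e: "dnabla d A B C (y $ 2) (cos (y $ 3)) / (\<rho> (y $ 2) (cos (y $ 3)))^2 =
      (if d = 2 then Q (y $ 2) * ((nabla_r A B C (y $ 2) (cos (y $ 3)) * \<rho> (y $ 2) (cos (y $ 3))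
          - 2 * y $ 2 * nabla A B C (y $ 2) (cos (y $ 3))) / (\<rho> (y $ 2) (cos (y $ 3)))^2)
       else if d = 3 then X (cos (y $ 3)) * ((nabla_c A B C (y $ 2) (cos (y $ 3)) * \<rho> (y $ 2) (cos (y $ 3))
          - 2 * a^2 * cos (y $ 3) * nabla A B C (y $ 2) (cos (y $ 3))) / (\<rho> (y $ 2) (cos (y $ 3)))^2)
       else 0)" for d
      unfolding dnabla_def by simp
    show ?case unfolding e
      by (rule has_partial_frame[OF 10, where G = "\<lambda>r c. nabla A B C r c / \<rho> r c"])
        (rule nabla_over_deriv[OF regular(3)[OF 10]])+
  next
    case (11 y A B C)
    then show ?case
      using regular(3)[OF 11] compatibility[of A "y $ 2" "cos (y $ 3)" B C] by simp
  next
    case (12 y C P B) then show ?case by (rule torsion)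
  qed
  show "einstein_frame (kerr_ds a m \<Lambda>) reg frame coframe
    (\<lambda>A y. hh A (y $ 2) (cos (y $ 3)) * \<rho> (y $ 2) (cos (y $ 3)))
    (\<lambda>A B C y. nabla A B C (y $ 2) (cos (y $ 3)) / \<rho> (y $ 2) (cos (y $ 3)))
    dframe ddframe
    (\<lambda>D A y. if D = 2 then Q (y $ 2) * square_r A (y $ 2) (cos (y $ 3))
       else if D = 3 then X (cos (y $ 3)) * square_c A (y $ 2) (cos (y $ 3)) else 0)
    (\<lambda>D A B C y. dnabla D A B C (y $ 2) (cos (y $ 3)) / (\<rho> (y $ 2) (cos (y $ 3)))^2)
    (\<lambda>A B C D y. weyl_comp A B C D (y $ 2) (cos (y $ 3))) \<kappa>"
  proof (unfold_locales, goal_cases)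
    case (1 y A B C D)
    define r c where "r = y $ 2" and "c = cos (y $ 3)"
    have \<rho>: "\<rho> r c \<noteq> 0"
      using regular(3)[OF 1] unfolding r_def c_def .
    \<comment> \<open>Each \<open>\<gamma>\<close> carries one factor \<open>1 / \<rho>\<close> and
      each \<open>d\<gamma>\<close> two, so all terms of \<open>R\<close> share the denominator
      \<open>\<rho>^2\<close>.\<close>
    have "R A B C D y = riem A B C D r c / (\<rho> r c)^2"
      unfolding R_def riem_def r_def[symmetric] c_def[symmetric]
      by (simp add: sum_divide_distrib power2_eq_square diff_divide_distrib add_divide_distrib
          algebra_simps)
    then have "hh A r c * \<rho> r c * R A B C D y = riem_weyl A B C D r c / \<rho> r c"
      using \<rho> hh_riem[of A r c B C D] by (simp add: power2_eq_square)
    also have "\<dots> = weyl_comp A B C D r c + \<kappa> * ((hh A r c * \<rho> r c) * (hh B r c * \<rho> r c) * kronecker A B C D)"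
      using \<rho> unfolding riem_weyl_def weyl_comp_def
      by (simp add: add_divide_distrib power3_eq_cube)
    finally show ?case
      unfolding kronecker_def r_def c_def by simp
  next
    case (2 y B D)
    then show ?case using weyl_trace regular by blast
  qed
qed

section \<open>The square of the Weyl tensor\<close>

text \<open>The first factor needs \<open>C\<close>, \<open>D\<close> to be \<open>A\<close>,
  \<open>B\<close> in some order, the second needs four distinct indices. This removes the mixed
  term from the square.\<close>

lemma kronecker_levi_civita: "kronecker A B C D * levi_civita A B C D = 0"
  unfolding kronecker_def levi_civita_def by auto

lemma kronecker_hh: "(kronecker A B C D)^2 * (hh A r c * hh B r c) = (kronecker A B C D)^2 * (hh C r c * hh D r c)"
  unfolding kronecker_def by auto

text \<open>Four distinct indices use every length once, and the single negative one gives the minus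
  sign. It is the Lorentzian signature that makes the Weyl square a difference of squares.\<close>

lemma levi_civita_hh:
  "(levi_civita A B C D)^2 * (hh A r c * hh B r c * (hh C r c * hh D r c)) =
   - ((levi_civita A B C D)^2 * (Q r * X c)^2)"
proof -
  have "\<forall>A B C D. levi_civita A B C D = 0 \<or>
      hh A r c * hh B r c * (hh C r c * hh D r c) = - ((Q r * X c)^2)"
    unfolding forall_4 levi_civita_def hh_def Let_def vector_4
    by (simp add: power2_eq_square)
  then have "levi_civita A B C D = 0 \<or>
      hh A r c * hh B r c * (hh C r c * hh D r c) = - ((Q r * X c)^2)"
    by blast
  then show ?thesis by auto
qed

text \<open>Four ordered pairs within a block weigh \<open>4\<close>, eight across weigh
  \<open>1\<close>, and each pair allows two orders of \<open>C\<close> and \<open>D\<close>: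
  \<open>2 * (16 + 8) = 48\<close>. The count for \<open>levi_civita\<close> is the same.\<close>

lemma sum_kronecker: "(\<Sum>A\<in>UNIV. \<Sum>B\<in>UNIV. \<Sum>C\<in>UNIV. \<Sum>D\<in>UNIV.
    (weyl_sign A B)^2 * (kronecker A B C D)^2) = 48"
  unfolding sum_4 weyl_sign_def kronecker_def by simp

lemma sum_levi_civita: "(\<Sum>A\<in>UNIV. \<Sum>B\<in>UNIV. \<Sum>C\<in>UNIV. \<Sum>D\<in>UNIV.
    (weyl_sign A B)^2 * (levi_civita A B C D)^2) = 48"
  unfolding sum_4 weyl_sign_def levi_civita_def by simp

lemma weyl_square_kerr:
  assumes "y \<in> reg"
  shows "weyl_square (kerr_ds a m \<Lambda>) y = 48 * ((weyl_re (y $ 2) (cos (y $ 3)))^2 - (weyl_im (y $ 2) (cos (y $ 3)))^2)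
    / (\<rho> (y $ 2) (cos (y $ 3)))^6"
proof -
  define r c where "r = y $ 2" and "c = cos (y $ 3)"
  have nz: "\<rho> r c \<noteq> 0"
    using regular[OF assms] unfolding r_def c_def by auto
  have hh: "hh A r c \<noteq> 0" for A
    using h_nonzero[OF assms, of A] unfolding r_def c_def by simp
  let ?p = "(weyl_re r c)^2 / (\<rho> r c)^6" and ?m = "(weyl_im r c)^2 / (\<rho> r c)^6"
  have "(weyl_comp A B C D r c)\<^sup>2 /
      (hh A r c * \<rho> r c * (hh B r c * \<rho> r c) * (hh C r c * \<rho> r c) * (hh D r c * \<rho> r c)) =
     ?p * ((weyl_sign A B)^2 * (kronecker A B C D)^2) - ?m * ((weyl_sign A B)^2 * (levi_civita A B C D)^2)"
    for A B C D
  proof -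
    define n where "n = hh A r c * hh B r c * (hh C r c * hh D r c)"
    define s k e u v where "s = weyl_sign A B" and "k = kronecker A B C D"
      and "e = levi_civita A B C D" and "u = weyl_re r c" and "v = weyl_im r c"
    have n: "n \<noteq> 0" unfolding n_def using hh by simp
    have ke: "k * e = 0"
      unfolding k_def e_def by (rule kronecker_levi_civita)
    have k: "k^2 * (hh A r c * hh B r c)^2 = k^2 * n"
      using kronecker_hh[of A B C D r c] unfolding k_def n_def
      by (auto simp: power2_eq_square)
    have e: "e^2 * (Q r * X c)^2 = - (e^2 * n)"
      using levi_civita_hh[of A B C D r c] unfolding e_def n_def by simp
    have "(u * (hh A r c * hh B r c * k) + v * (Q r * X c * e))^2 =
        u^2 * (k^2 * (hh A r c * hh B r c)^2) + v^2 * (e^2 * (Q r * X c)^2)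
        + 2 * u * v * hh A r c * hh B r c * Q r * X c * (k * e)"
      by algebra
    also have "\<dots> = (u^2 * k^2 - v^2 * e^2) * n"
      unfolding ke k e by algebra
    finally have "(weyl_comp A B C D r c)\<^sup>2 = s^2 * ((u^2 * k^2 - v^2 * e^2) * n) / (\<rho> r c)^2"
      unfolding weyl_comp_def s_def k_def e_def u_def v_def
      by (simp add: power_divide power_mult_distrib)
    moreover have "hh A r c * \<rho> r c * (hh B r c * \<rho> r c) * (hh C r c * \<rho> r c) * (hh D r c * \<rho> r c) = n * (\<rho> r c)^4"
      unfolding n_def by algebra
    ultimately have "(weyl_comp A B C D r c)\<^sup>2 /
        (hh A r c * \<rho> r c * (hh B r c * \<rho> r c) * (hh C r c * \<rho> r c) * (hh D r c * \<rho> r c)) =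
        s^2 * ((u^2 * k^2 - v^2 * e^2) * n) / (\<rho> r c)^2 / (n * (\<rho> r c)^4)"
      by (simp only:)
    also have "\<dots> = s^2 * (u^2 * k^2 - v^2 * e^2) / (\<rho> r c)^6"
      using n by (simp flip: power_add)
    also have "\<dots> = u^2 / (\<rho> r c)^6 * (s^2 * k^2) - v^2 / (\<rho> r c)^6 * (s^2 * e^2)"
      by (simp add: diff_divide_distrib right_diff_distrib mult_ac)
    finally show ?thesis
      unfolding s_def k_def e_def u_def v_def .
  qed
  then have "weyl_square (kerr_ds a m \<Lambda>) y = (\<Sum>A\<in>UNIV. \<Sum>B\<in>UNIV. \<Sum>C\<in>UNIV. \<Sum>D\<in>UNIV.
     ?p * ((weyl_sign A B)^2 * (kronecker A B C D)^2) - ?m * ((weyl_sign A B)^2 * (levi_civita A B C D)^2))"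
    unfolding weyl_square_eq[OF assms] r_def[symmetric] c_def[symmetric] by (simp only:)
  also have "\<dots> = ?p * 48 - ?m * 48"
  proof -
    have "(\<Sum>A\<in>UNIV. \<Sum>B\<in>UNIV. \<Sum>C\<in>UNIV. \<Sum>D\<in>UNIV.
        ?p * ((weyl_sign A B)^2 * (kronecker A B C D)^2)) = ?p * 48"
      unfolding sum_kronecker[symmetric] by (simp only: sum_distrib_left)
    moreover have "(\<Sum>A\<in>UNIV. \<Sum>B\<in>UNIV. \<Sum>C\<in>UNIV. \<Sum>D\<in>UNIV.
        ?m * ((weyl_sign A B)^2 * (levi_civita A B C D)^2)) = ?m * 48"
      unfolding sum_levi_civita[symmetric] by (simp only: sum_distrib_left)
    ultimately show ?thesis by (simp only: sum_subtractf)
  qed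
  finally show ?thesis
    unfolding r_def c_def by (simp add: diff_divide_distrib right_diff_distrib mult.commute)
qed

section \<open>The invariant as a function of \<open>r\<close> and \<open>c\<close>\<close>

definition weyl_square_rc :: "real \<Rightarrow> real \<Rightarrow> real" where
  "weyl_square_rc r c = 48 * ((weyl_re r c)^2 - (weyl_im r c)^2) / (\<rho> r c)^6"

text \<open>The outcome of the quotient rule with the common factor \<open>288 = 6 * 48\<close>
  taken out.\<close>

definition weyl_square_r :: "real \<Rightarrow> real \<Rightarrow> real" where
  "weyl_square_r r c = 288 * m * ((weyl_re r c * (r^2 - (a * c)^2) - weyl_im r c * (2 * r * a * c)) * \<rho> r c
     - 2 * r * m * ((r^3 - 3 * r * (a * c)^2)^2 - (3 * r^2 * (a * c) - (a * c)^3)^2)) / (\<rho> r c)^7"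

definition weyl_square_c :: "real \<Rightarrow> real \<Rightarrow> real" where
  "weyl_square_c r c = 288 * m * ((weyl_re r c * (- 2 * r * a^2 * c) - weyl_im r c * (a * r^2 - a^3 * c^2)) * \<rho> r c
     - 2 * a^2 * c * m * ((r^3 - 3 * r * (a * c)^2)^2 - (3 * r^2 * (a * c) - (a * c)^3)^2)) / (\<rho> r c)^7"

lemma quotient_rule6:
  fixes f p :: "real \<Rightarrow> real"
  assumes "(f has_real_derivative f') (at t)" "(p has_real_derivative p') (at t)" "p t \<noteq> 0"
  shows "((\<lambda>t. f t / (p t)^6) has_real_derivative (f' * p t - 6 * p' * f t) / (p t)^7) (at t)"
  using assms
  by (auto intro!: derivative_eq_intros simp: divide_simps) (simp add: algebra_simps eval_nat_numeral)

lemma weyl_square_deriv: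
  assumes "\<rho> r c \<noteq> 0"
  shows "((\<lambda>r. weyl_square_rc r c) has_real_derivative weyl_square_r r c) (at r)"
    and "((\<lambda>c. weyl_square_rc r c) has_real_derivative weyl_square_c r c) (at c)"
proof -
  have re: "((\<lambda>r. weyl_re r c) has_real_derivative m * (3 * r^2 - 3 * (a * c)^2)) (at r)"
    "((\<lambda>c. weyl_re r c) has_real_derivative m * (- 6 * r * a^2 * c)) (at c)"
    unfolding weyl_re_def by (auto intro!: derivative_eq_intros simp: algebra_simps power2_eq_square)
  have im: "((\<lambda>r. weyl_im r c) has_real_derivative m * (6 * r * a * c)) (at r)"
    "((\<lambda>c. weyl_im r c) has_real_derivative m * (3 * a * r^2 - 3 * a^3 * c^2)) (at c)"
    unfolding weyl_im_def by (auto intro!: derivative_eq_intros simp: algebra_simps power2_eq_square power3_eq_cube)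
  have 1: "((\<lambda>r. 48 * ((weyl_re r c)^2 - (weyl_im r c)^2)) has_real_derivative
      48 * (2 * weyl_re r c * (m * (3 * r^2 - 3 * (a * c)^2)) - 2 * weyl_im r c * (m * (6 * r * a * c)))) (at r)"
    by (auto intro!: derivative_eq_intros re im)
  have 2: "((\<lambda>c. 48 * ((weyl_re r c)^2 - (weyl_im r c)^2)) has_real_derivative
      48 * (2 * weyl_re r c * (m * (- 6 * r * a^2 * c)) - 2 * weyl_im r c * (m * (3 * a * r^2 - 3 * a^3 * c^2)))) (at c)"
    by (auto intro!: derivative_eq_intros re im)
  show "((\<lambda>r. weyl_square_rc r c) has_real_derivative weyl_square_r r c) (at r)"
    unfolding weyl_square_rc_def weyl_square_r_def
    by (rule DERIV_cong[OF quotient_rule6[OF 1 \<rho>_deriv(1) assms]], rule arg_cong[of _ _ "\<lambda>z. z / _"])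
      (unfold weyl_re_def weyl_im_def, algebra)
  show "((\<lambda>c. weyl_square_rc r c) has_real_derivative weyl_square_c r c) (at c)"
    unfolding weyl_square_rc_def weyl_square_c_def
    by (rule DERIV_cong[OF quotient_rule6[OF 2 \<rho>_deriv(2) assms]], rule arg_cong[of _ _ "\<lambda>z. z / _"])
      (unfold weyl_re_def weyl_im_def, algebra)
qed

text \<open>The gradient components carry \<open>Q\<close> and \<open>X\<close>, the squared lengths
  only one factor of each; after cancellation the sole denominators are powers of
  \<open>\<rho>\<close>, and the formula extends across the axis and the horizons.\<close>

definition I5_rc :: "real \<Rightarrow> real \<Rightarrow> real" where
  "I5_rc r c = (Q r * (weyl_square_r r c)^2 + X c * (weyl_square_c r c)^2) / \<rho> r c"

lemma I5_kerr:
  assumes "y \<in> reg"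
  shows "I5 (kerr_ds a m \<Lambda>) y = I5_rc (y $ 2) (cos (y $ 3))"
proof -
  note nz = regular[OF assms]
  have "I5 (kerr_ds a m \<Lambda>) y = (\<Sum>A\<in>UNIV. (if A = 2 then Q (y $ 2) * weyl_square_r (y $ 2) (cos (y $ 3))
      else if A = 3 then X (cos (y $ 3)) * weyl_square_c (y $ 2) (cos (y $ 3)) else 0)\<^sup>2
      / (hh A (y $ 2) (cos (y $ 3)) * \<rho> (y $ 2) (cos (y $ 3))))"
  proof (rule I5_eq[OF assms])
    show "weyl_square (kerr_ds a m \<Lambda>) z = weyl_square_rc (z $ 2) (cos (z $ 3))" if "z \<in> reg" for z
      using weyl_square_kerr[OF that] unfolding weyl_square_rc_def .
    show "has_partial i (\<lambda>z. weyl_square_rc (z $ 2) (cos (z $ 3))) (\<Sum>A\<in>UNIV. coframe y $ A $ i *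
      (if A = 2 then Q (y $ 2) * weyl_square_r (y $ 2) (cos (y $ 3))
      else if A = 3 then X (cos (y $ 3)) * weyl_square_c (y $ 2) (cos (y $ 3)) else 0)) y" for i
      by (rule has_partial_frame[OF assms]) (rule weyl_square_deriv[OF nz(3)])+
  qed
  also have "\<dots> = I5_rc (y $ 2) (cos (y $ 3))"
    unfolding sum_4 hh_def I5_rc_def using nz by (simp add: field_simps power2_eq_square)
  finally show ?thesis .
qed

text \<open>The constant is \<open>288^2 * 49 / 3\<close>: the square of the factor in
  \<open>weyl_square_r\<close>, \<open>7^2\<close> from clearing the fraction in the sextic, and
  \<open>3\<close> from \<open>Q = - T / 3\<close>.\<close>

lemma I5_rc_axis:
  "I5_rc r 1 = - (1354752 * m^4 * (a^6 - 5 * a^4 * r^2 + 3 * a^2 * r^4 - 1/7 * r^6)^2 * r^2 *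
    (\<Lambda> * r^4 + (\<Lambda> * a^2 - 3) * r^2 + 6 * m * r - 3 * a^2)) / (a^2 + r^2)^15"
proof -
  define s where "s = 7 * a^6 - 35 * a^4 * r^2 + 21 * a^2 * r^4 - r^6"
  have s: "a^6 - 5 * a^4 * r^2 + 3 * a^2 * r^4 - 1/7 * r^6 = s / 7"
    unfolding s_def by simp
  define b T where "b = a^2 + r^2"
    and "T = \<Lambda> * r^4 + (\<Lambda> * a^2 - 3) * r^2 + 6 * m * r - 3 * a^2"
  have \<rho>: "\<rho> r 1 = b"
    unfolding \<rho>_def b_def by simp
  have X: "X 1 = 0"
    unfolding X_def by simp
  have w: "weyl_square_r r 1 = 288 * m^2 * r * s / b^7"
    unfolding weyl_square_r_def \<rho>
    by (rule arg_cong[of _ _ "\<lambda>z. z / _"]) (unfold weyl_re_def weyl_im_def s_def b_def, algebra)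
  have Q: "Q r = - T / 3"
    unfolding Q_def \<kappa>_def T_def by (simp add: field_simps)
  have "I5_rc r 1 = - T / 3 * (82944 * m^4 * r^2 * s^2 / b^14) / b"
    unfolding I5_rc_def X \<rho> w Q
    by (simp add: power_divide power_mult_distrib flip: power_mult)
  also have "\<dots> = - (1354752 * m^4 * (s / 7)^2 * r^2 * T) / (b^14 * b)"
    by (simp add: power_divide mult_ac)
  also have "b^14 * b = b^15"
    by (simp flip: power_Suc2)
  finally show ?thesis
    unfolding s b_def T_def .
qed

section \<open>Continuation to the axis\<close>

lemma Q_roots_finite: "finite {r. Q r = 0}"
proof -
  let ?p = "[:a^2, - 2 * m, 1 - a^2 * \<kappa>, 0, - \<kappa>:]"
  \<comment> \<open>If the leading coefficient vanishes, then \<open>\<kappa> = 0\<close> and the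
    coefficient of \<open>r^2\<close> is \<open>1\<close>.\<close>
  have "?p \<noteq> 0" by auto
  then have "finite {r. poly ?p r = 0}" by (rule poly_roots_finite)
  moreover have "poly ?p r = Q r" for r
    unfolding Q_def by (simp add: algebra_simps eval_nat_numeral)
  ultimately show ?thesis by simp
qed

text \<open>A \<open>Lim\<close> is determined by convergence only along a nontrivial filter, so
  regular points must accumulate at the axis point.\<close>

lemma axis_limit_point:
  assumes "r^2 + a^2 \<noteq> 0"
  shows "at (vector [t, r, 0, \<phi>]) within reg \<noteq> bot"
proof
  \<comment> \<open>The radius moves together with the angle, since \<open>r\<close> itself may be a
    root of \<open>Q\<close>; the roots being finite in number, small \<open>e\<close> avoid
    them.\<close>
  define path :: "real \<Rightarrow> real^4" where "path e = vector [t, r + e, e, \<phi>]" for e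
  let ?F = "at_right (0::real)"
  have e: "((\<lambda>e. e) \<longlongrightarrow> 0) ?F" by (rule tendsto_ident_at)
  have "\<forall>i. ((\<lambda>e. path e $ i) \<longlongrightarrow> (vector [t, r, 0, \<phi>] :: real^4) $ i) ?F"
    unfolding forall_4 path_def using tendsto_add[OF tendsto_const e, of r] e by simp
  then have lim: "(path \<longlongrightarrow> vector [t, r, 0, \<phi>]) ?F"
    by (intro vec_tendstoI) blast
  have pos: "\<forall>\<^sub>F e in ?F. 0 < e \<and> e < pi"
    by (intro eventually_conj eventually_at_right_less eventually_at_rightI[of 0 pi]) auto
  have "\<forall>\<^sub>F r' in at r. r' \<notin> {r. Q r = 0}"
    using islimpt_finite[OF Q_roots_finite] islimpt_iff_eventually by blast
  moreover have "filterlim (\<lambda>e. r + e) (at r) ?F"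
    unfolding filterlim_at using tendsto_add[OF tendsto_const e, of r] pos
    by (auto elim: eventually_mono)
  ultimately have "\<forall>\<^sub>F e in ?F. r + e \<notin> {r. Q r = 0}"
    unfolding filterlim_iff by blast
  moreover have "\<forall>\<^sub>F e in ?F. \<Delta> e \<noteq> 0"
  proof (rule tendsto_imp_eventually_ne)
    show "(\<Delta> \<longlongrightarrow> 1 + a^2 * \<kappa> * (cos 0)^2) ?F"
      unfolding \<Delta>_def [abs_def] by (intro tendsto_intros e)
    show "1 + a^2 * \<kappa> * (cos 0)^2 \<noteq> 0"
      using Xi_nonzero unfolding Xi_def \<kappa>_def by simp
  qed
  moreover have "\<forall>\<^sub>F e in ?F. \<rho> (r + e) (cos e) \<noteq> 0"
  proof (rule tendsto_imp_eventually_ne)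
    show "((\<lambda>e. \<rho> (r + e) (cos e)) \<longlongrightarrow> (r + 0)^2 + a^2 * (cos 0)^2) ?F"
      unfolding \<rho>_def by (intro tendsto_intros e)
    show "(r + 0)^2 + a^2 * (cos 0)^2 \<noteq> 0" using assms by simp
  qed
  ultimately have "\<forall>\<^sub>F e in ?F. path e \<in> reg \<and> path e \<noteq> vector [t, r, 0, \<phi>]"
    using pos
  proof eventually_elim
    case (elim e)
    then have "sin e \<noteq> 0" using sin_gt_zero[of e] by simp
    with elim have "path e \<in> reg"
      unfolding regular_points_def path_def by (simp add: Delta_r_eq Delta_theta_eq rho2_eq)
    moreover have "path e $ 3 \<noteq> (vector [t, r, 0, \<phi>] :: real^4) $ 3"
      using elim unfolding path_def by simp
    ultimately show ?case by metis
  qed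
  with lim have "filterlim path (at (vector [t, r, 0, \<phi>]) within reg) ?F"
    unfolding filterlim_at by simp
  moreover assume "at (vector [t, r, 0, \<phi>]) within reg = bot"
  ultimately show False
    using trivial_limit_at_right_real[of "0::real"] unfolding filterlim_def
    by (simp add: bot_unique filtermap_bot_iff)
qed

lemma I5_tendsto_axis:
  assumes "r^2 + a^2 \<noteq> 0"
  shows "(I5 (kerr_ds a m \<Lambda>) \<longlongrightarrow> I5_rc r 1) (at (vector [t, r, 0, \<phi>]) within reg)"
proof -
  let ?p = "vector [t, r, 0, \<phi>] :: real^4"
  have "isCont (\<lambda>y. I5_rc (y $ 2) (cos (y $ 3))) ?p"
    unfolding I5_rc_def weyl_square_r_def weyl_square_c_def weyl_re_def weyl_im_def Q_def X_def \<rho>_def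
    using assms by (intro continuous_intros) auto
  then have "((\<lambda>y. I5_rc (y $ 2) (cos (y $ 3))) \<longlongrightarrow> I5_rc r 1) (at ?p)"
    unfolding isCont_def by simp
  then have "((\<lambda>y. I5_rc (y $ 2) (cos (y $ 3))) \<longlongrightarrow> I5_rc r 1) (at ?p within reg)"
    by (rule tendsto_within_subset) simp
  moreover have "\<forall>\<^sub>F y in at ?p within reg. I5_rc (y $ 2) (cos (y $ 3)) = I5 (kerr_ds a m \<Lambda>) y"
    by (simp add: eventually_at_filter I5_kerr)
  ultimately show ?thesis
    by (rule Lim_transform_eventually)
qed

lemma kerr_I5_axis:
  assumes "r^2 + a^2 \<noteq> 0"
  shows "kerr_I5 a m \<Lambda> (vector [t, r, 0, \<phi>]) = I5_rc r 1"
proof -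
  have "vector [t, r, 0, \<phi>] \<notin> reg"
    unfolding regular_points_def by simp
  then show ?thesis
    unfolding kerr_I5_def
    using tendsto_Lim[OF axis_limit_point[OF assms] I5_tendsto_axis[OF assms]] by simp
qed

end

section \<open>The sextic polynomial\<close>

text \<open>The sextic is homogeneous of degree six in \<open>a\<close> and \<open>r\<close>, so its
  roots scale with \<open>a\<close>.\<close>

lemma sextic_scaled:
  assumes "a \<noteq> 0"
  shows "sextic a r = a^6 / 7 * (7 - 35 * (r / a)^2 + 21 * (r / a)^4 - (r / a)^6)"
  using assms unfolding sextic_def by (simp add: field_simps)

text \<open>Vieta: the roots of the cubic add up to \<open>21\<close>. The product in the proof is
  the Vandermonde determinant times the second divided difference of the cubic, hence a combination
  of the three equations.\<close>

lemma cubic_third_root: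
  fixes u v w :: real
  assumes "7 - 35 * u + 21 * u^2 - u^3 = 0" "7 - 35 * v + 21 * v^2 - v^3 = 0"
    "7 - 35 * w + 21 * w^2 - w^3 = 0" "u \<noteq> v" "u \<noteq> w" "v \<noteq> w"
  shows "w = 21 - u - v"
proof -
  have "(u - v) * (w - u) * (w - v) * (21 - u - v - w) = 0"
    using assms(1-3) by algebra
  with assms(4-6) show ?thesis by simp
qed

text \<open>Sign changes locate three roots; there are no others, as the polynomial is a cubic in
  \<open>x^2\<close> and a positive number is determined by its square. The intervals are half-open
  because the decimals are cut off, not rounded.\<close>

lemma sextic_roots:
  obtains x y z :: real where
    "{x. 0 < x \<and> 7 - 35 * x^2 + 21 * x^4 - x^6 = 0} = {x, y, z}"
    "0.481574618807 \<le> x" "x < 0.481574618808"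
    "1.2539603376 \<le> y" "y < 1.2539603377"
    "4.3812862675 \<le> z" "z < 4.3812862676"
proof -
  let ?f = "\<lambda>x::real. 7 - 35 * x^2 + 21 * x^4 - x^6"
  have root: "\<exists>x. l \<le> x \<and> x < u \<and> ?f x = 0" if "l \<le> u" "?f l * ?f u < 0" for l u
  proof -
    have c: "continuous_on {l..u} ?f" by (intro continuous_intros)
    have "\<exists>x. l \<le> x \<and> x \<le> u \<and> ?f x = 0"
    proof (cases "?f l \<le> 0")
      case True
      with that have "0 \<le> ?f u" by (auto simp: mult_less_0_iff)
      with True show ?thesis using IVT'[of ?f l 0 u] that c by blast
    next
      case False
      with that have "?f u \<le> 0" by (auto simp: mult_less_0_iff)
      with False show ?thesis using IVT2'[of ?f u 0 l] that c by force
    qed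
    moreover have "?f u \<noteq> 0" using that by auto
    ultimately show ?thesis by (metis order_le_less)
  qed
  obtain x where x: "0.481574618807 \<le> x" "x < 0.481574618808" "?f x = 0"
    using root[of "0.481574618807" "0.481574618808"] by (auto simp: power_divide)
  obtain y where y: "1.2539603376 \<le> y" "y < 1.2539603377" "?f y = 0"
    using root[of "1.2539603376" "1.2539603377"] by (auto simp: power_divide)
  obtain z where z: "4.3812862675 \<le> z" "z < 4.3812862676" "?f z = 0"
    using root[of "4.3812862675" "4.3812862676"] by (auto simp: power_divide)
  have cubic: "7 - 35 * x^2 + 21 * (x^2)^2 - (x^2)^3 = 0" if "?f x = 0" for x
    using that by (simp flip: power_mult)
  have lt: "x^2 < y^2" "y^2 < z^2"
    using x y z by (auto intro!: power_strict_mono)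
  have "w \<in> {x, y, z}" if w: "0 < w" "?f w = 0" for w
  proof -
    have "w^2 = x^2 \<or> w^2 = y^2 \<or> w^2 = z^2"
      \<comment> \<open>A further root \<open>w^2\<close> distinct from \<open>x^2\<close> and
        \<open>y^2\<close> would be \<open>21 - x^2 - y^2\<close>, which is already
        \<open>z^2\<close>.\<close>
      using cubic_third_root[of "x^2" "y^2" "z^2"] cubic_third_root[of "x^2" "y^2" "w^2"]
        cubic[OF x(3)] cubic[OF y(3)] cubic[OF z(3)] cubic[OF w(2)] lt by force
    then show ?thesis using w x y z by (auto simp: power2_eq_iff)
  qed
  moreover have "0 < x" "0 < y" "0 < z" using x y z by auto
  ultimately have "{x. 0 < x \<and> ?f x = 0} = {x, y, z}"
    using x(3) y(3) z(3) by blast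
  then show ?thesis using that x y z by blast
qed

text \<open>\<open>Lim\<close> has some value even without convergence, so the limit is asserted
  beside the formula. On the axis \<open>rho2\<close> is \<open>r^2 + a^2\<close>, which vanishes
  only if \<open>a = r = 0\<close>.\<close>

theorem corollary20:
  fixes a m \<Lambda> :: real
  assumes "Xi a \<Lambda> \<noteq> 0"
  shows
    "(\<forall>t r \<phi>. r^2 + a^2 \<noteq> 0 \<longrightarrow>
        (I5 (kerr_ds a m \<Lambda>) \<longlongrightarrow> kerr_I5 a m \<Lambda> (vector [t, r, 0, \<phi>]))
          (at (vector [t, r, 0, \<phi>]) within regular_points a m \<Lambda>) \<and>
        kerr_I5 a m \<Lambda> (vector [t, r, 0, \<phi>]) =
          - (1354752 * m^4 * (a^6 - 5 * a^4 * r^2 + 3 * a^2 * r^4 - 1/7 * r^6)^2 * r^2 *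
              (\<Lambda> * r^4 + (\<Lambda> * a^2 - 3) * r^2 + 6 * m * r - 3 * a^2)) / (a^2 + r^2)^15) \<and>
     (a > 0 \<and> kerr_ds_black_hole a m \<Lambda> \<longrightarrow>
        (\<forall>t r \<phi>. Delta_r a m \<Lambda> r = 0 \<longrightarrow> kerr_I5 a m \<Lambda> (vector [t, r, 0, \<phi>]) = 0) \<and>
        (\<forall>t r \<phi>. r > 0 \<and> sextic a r = 0 \<longrightarrow> kerr_I5 a m \<Lambda> (vector [t, r, 0, \<phi>]) = 0) \<and>
        (\<exists>r\<^sub>1 r\<^sub>2 r\<^sub>3. {r. r > 0 \<and> sextic a r = 0} = {r\<^sub>1, r\<^sub>2, r\<^sub>3} \<and>
           decimal_approx 12 (r\<^sub>1 / a)  481574618807 \<and>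
           decimal_approx 10 (r\<^sub>2 / a) 12539603376 \<and>
           decimal_approx 10 (r\<^sub>3 / a) 43812862675))"
proof -
  interpret kerr_parameters a m \<Lambda>
    using assms by unfold_locales
  have axis: "kerr_I5 a m \<Lambda> (vector [t, r, 0, \<phi>]) =
      - (1354752 * m^4 * (sextic a r)^2 * r^2 *
          (\<Lambda> * r^4 + (\<Lambda> * a^2 - 3) * r^2 + 6 * m * r - 3 * a^2)) / (a^2 + r^2)^15"
    if "r^2 + a^2 \<noteq> 0" for t r \<phi>
    unfolding sextic_def kerr_I5_axis[OF that] by (rule I5_rc_axis)
  have roots: "\<exists>r\<^sub>1 r\<^sub>2 r\<^sub>3. {r. r > 0 \<and> sextic a r = 0} = {r\<^sub>1, r\<^sub>2, r\<^sub>3} \<and>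
      decimal_approx 12 (r\<^sub>1 / a) 481574618807 \<and> decimal_approx 10 (r\<^sub>2 / a) 12539603376 \<and>
      decimal_approx 10 (r\<^sub>3 / a) 43812862675" if "a > 0"
  proof -
    obtain x y z :: real where eq: "{x. 0 < x \<and> 7 - 35 * x^2 + 21 * x^4 - x^6 = 0} = {x, y, z}"
      and b: "0.481574618807 \<le> x" "x < 0.481574618808" "1.2539603376 \<le> y" "y < 1.2539603377"
        "4.3812862675 \<le> z" "z < 4.3812862676"
      by (rule sextic_roots)
    have "r > 0 \<and> sextic a r = 0 \<longleftrightarrow> r / a \<in> {x, y, z}" for r
      unfolding eq[symmetric] using that by (simp add: sextic_scaled zero_less_divide_iff)
    then have "{r. r > 0 \<and> sextic a r = 0} = {a * x, a * y, a * z}"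
      using that by (auto simp: field_simps)
    moreover have "decimal_approx 12 (a * x / a) 481574618807" "decimal_approx 10 (a * y / a) 12539603376"
      "decimal_approx 10 (a * z / a) 43812862675"
      using that b unfolding decimal_approx_def by (auto simp: floor_eq_iff)
    ultimately show ?thesis by blast
  qed
  show ?thesis
  proof (intro conjI allI impI; (elim conjE)?)
    fix t r \<phi> :: real
    assume r: "r^2 + a^2 \<noteq> 0"
    show "(I5 (kerr_ds a m \<Lambda>) \<longlongrightarrow> kerr_I5 a m \<Lambda> (vector [t, r, 0, \<phi>]))
          (at (vector [t, r, 0, \<phi>]) within regular_points a m \<Lambda>)"
      unfolding kerr_I5_axis[OF r] by (rule I5_tendsto_axis[OF r])
    show "kerr_I5 a m \<Lambda> (vector [t, r, 0, \<phi>]) =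
          - (1354752 * m^4 * (a^6 - 5 * a^4 * r^2 + 3 * a^2 * r^4 - 1/7 * r^6)^2 * r^2 *
              (\<Lambda> * r^4 + (\<Lambda> * a^2 - 3) * r^2 + 6 * m * r - 3 * a^2)) / (a^2 + r^2)^15"
      using axis[OF r] unfolding sextic_def .
  next
    fix t r \<phi> :: real
    assume a: "a > 0"
    then have r: "r^2 + a^2 \<noteq> 0" by (simp add: sum_power2_eq_zero_iff)
    {
      assume "Delta_r a m \<Lambda> r = 0"
      moreover have "\<Lambda> * r^4 + (\<Lambda> * a^2 - 3) * r^2 + 6 * m * r - 3 * a^2 = - 3 * Delta_r a m \<Lambda> r"
        unfolding Delta_r_def by (simp add: field_simps eval_nat_numeral)
      ultimately show "kerr_I5 a m \<Lambda> (vector [t, r, 0, \<phi>]) = 0"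
        unfolding axis[OF r] by simp
    }
    assume "sextic a r = 0"
    then show "kerr_I5 a m \<Lambda> (vector [t, r, 0, \<phi>]) = 0"
      unfolding axis[OF r] by simp
  qed (use roots in blast)
qed

end
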